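(* Let $H$ be a Hopf algebra and let $(R,m,u,\delta,\varepsilon)$ be an $N$-dimensional pre-bialgebra in ${}_H^H\mathcal{YD}$ with cocycle $\xi$. Assume that $R$ is a thin coalgebra with $P(R)=Ky$, let $(H,g,\chi)$ be the Yetter-Drinfeld datum associated to $y$, let $q=\chi(g)$, and let $d_0=1_R,d_1=y,\ldots,d_{N-1}$ be a divided power basis of $R$ as described in the context. For $N$ even put $x:=\xi(d_1\otimes d_{N/2-1})$. Set $Y:=y\otimes 1_H\in R\#_\xi H$. Powers of $y$ are taken in $R$ and powers of $Y$ in $R\#_\xi H$. 1) If $N$ is even, then $$\xi(y\otimes y^{N/2-1})=\xi(y^2\otimes y^{N/2-2})=\cdots=\xi(y^{N/2-1}\otimes y)=(N/2-1)_q!\,x .$$ 2) If $N$ is odd, or if $N$ is even and $x^2=0$, then $$\xi(y\otimes y^{N-1})=\xi(y^2\otimes y^{N-2})=\cdots=\xi(y^{N-1}\otimes y),$$ and moreover in $R\#_\xi H$ we have $Y^N=1_R\otimes \xi(y\otimes y^{N-1})$. 3) If $N$ is even and $x=0$, then $$\xi(y\otimes y^{3N/2-1})=\xi(y^2\otimes y^{3N/2-2})=\cdots=\xi(y^{3N/2-1}\otimes y)=0 .$$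
   Context: $K$ is a field of characteristic $0$; everything is over $K$. Yetter-Drinfeld modules. For a Hopf algebra $H$ with antipode $S$, an object $V$ of ${}_H^H\mathcal{YD}$ is a left $H$-module and left $H$-comodule (coaction $\rho(v)=\sum v_{\langle -1\rangle}\otimes v_{\langle 0\rangle}$) with $\rho(hv)=\sum h_{(1)}v_{\langle -1\rangle}S(h_{(3)})\otimes h_{(2)}v_{\langle 0\rangle}$. Tensor products carry the diagonal action and codiagonal coaction; the unit object is $K$. If $(R,\delta,\varepsilon)$ is a coalgebra in ${}_H^H\mathcal{YD}$, with $\delta(r)=\sum r^{(1)}\otimes r^{(2)}$, then $R\otimes R$ is a coalgebra via $\delta_{R\otimes R}(r\otimes s)=\sum r^{(1)}\otimes r^{(2)}_{\langle -1\rangle}s^{(1)}\otimes r^{(2)}_{\langle 0\rangle}\otimes s^{(2)}$. Pre-bialgebra. A pre-bialgebra $(R,m,u,\delta,\varepsilon)$ in ${}_H^H\mathcal{YD}$ is a coalgebra $(R,\delta,\varepsilon)$ in ${}_H^H\mathcal{YD}$ with $K$-linear maps $m:R\otimes R\to R$, $u:K\to R$ (write $1_R=u(1)$) such that $h1_R=\varepsilon_H(h)1_R$, $\rho(1_R)=1_H\otimes 1_R$, $\delta(1_R)=1_R\otimes 1_R$, $\varepsilon(1_R)=1$, $h\,m(r\otimes s)=\sum m(h_{(1)}r\otimes h_{(2)}s)$, $\delta m=(m\otimes m)\delta_{R\otimes R}$, $\varepsilon m=\varepsilon\otimes\varepsilon$, $m(r\otimes 1_R)=r=m(1_R\otimes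 r)$. (Associativity and $H$-colinearity of $m$ are not required.) Cocycle. A cocycle for it is a $K$-linear map $\xi:R\otimes R\to H$ such that, with $m_H$ the multiplication of $H$, $\mu_R:H\otimes R\to R$ the action, $c_{R,H}(r\otimes h)=\sum r_{\langle -1\rangle}h\otimes r_{\langle 0\rangle}$ and $c_{H,R}(h\otimes r)=\sum h_{(1)}r\otimes h_{(2)}$: $\sum\xi(h_{(1)}r\otimes h_{(2)}s)=\sum h_{(1)}\xi(r\otimes s)S(h_{(2)})$; $\Delta_H\xi=(m_H\otimes\xi)(\xi\otimes\rho_{R\otimes R})\delta_{R\otimes R}$ and $\varepsilon_H\xi=\varepsilon\otimes\varepsilon$; $c_{R,H}(m\otimes\xi)\delta_{R\otimes R}=(m_H\otimes m)(\xi\otimes\rho_{R\otimes R})\delta_{R\otimes R}$; $m(R\otimes m)=m(R\otimes\mu_R)[(m\otimes\xi)\delta_{R\otimes R}\otimes R]$; $m_H(\xi\otimes H)[R\otimes(m\otimes\xi)\delta_{R\otimes R}]=m_H(\xi\otimes H)(R\otimes c_{H,R})[(m\otimes\xi)\delta_{R\otimes R}\otimes R]$; $\xi(r\otimes 1_R)=\xi(1_R\otimes r)=\varepsilon(r)1_H$. The bialgebra $R\#_\xi H$ is $R\otimes H$ with unit $1_R\otimes 1_H$, counit $\varepsilon\otimes\varepsilon_H$, $\Delta(r\# h)=\sum r^{(1)}\# r^{(2)}_{\langle -1\rangle}h_{(1)}\otimes r^{(2)}_{\langle 0\rangle}\# h_{(2)}$ and product $(r\# h)(s\# k)=\sum \widetilde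 m^0(r\otimes h_{(1)}s)\#\widetilde m^1(r\otimes h_{(1)}s)h_{(2)}k$, where $\sum\widetilde m^0(r\otimes s)\otimes\widetilde m^1(r\otimes s)=(m\otimes\xi)\delta_{R\otimes R}(r\otimes s)$. Thin. A coalgebra $C$ is thin if its coradical $C_0$ is one-dimensional and its space $P(C)$ of primitive elements is one-dimensional. Yetter-Drinfeld datum. For $q$ a primitive $\theta$-th root of unity, a Yetter-Drinfeld datum $(H,g,\chi)$ for $q$ consists of a group-like $g\in G(H)$ and a character (algebra map) $\chi:H\to K$ with $\chi(g)=q$ and $g\sum\chi(h_{(1)})h_{(2)}=\sum h_{(1)}\chi(h_{(2)})g$ for all $h\in H$. If $R$ is a finite-dimensional pre-bialgebra which is thin with $P(R)=Ky$, it is known that there are a primitive $\theta$-th root of unity $q$ ($2\le\theta\le\dim R$) and a Yetter-Drinfeld datum $(H,g,\chi)$ for $q$ with $\rho(y)=g\otimes y$ and $hy=\chi(h)y$; it is called the Yetter-Drinfeld datum associated to $y$. Divided power basis. $(n)_q=1+q+\cdots+q^{n-1}$, $(n)_q!=(1)_q\cdots(n)_q$, $\chi^n$ is the convolution power. One fixes a basis $d_0=1_R,d_1=y,\ldots,d_{N-1}$ of $R$ with $\delta(d_n)=\sum_{t=0}^n d_t\otimes d_{n-t}$, $gd_n=q^nd_n$, $hd_n=\chi^n(h)d_n$ for $h\in H$, and $yd_{n-1}=(n)_qd_n$ for $1\le n\le N-1$ (such a basis is known to exist). It is known that in this situation $R$ is an associative algebra, $q$ has order $N$, $y^n=(n)_q!\,d_n$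 for $0\le n\le N-1$, and $y^N=0$ (so $y^n=0$ for $n\geq N$). *)

theory Defs
  imports Main "HOL.Vector_Spaces"
begin

text \<open>
  Conventions.  Vector spaces over the field \<open>'k\<close> are types with a scaling function
  (\<^locale>\<open>vector_space\<close>).  An element of \<open>A \<otimes> B\<close> is represented by a list
  \<open>[(a1,b1), ..., (an,bn)]\<close> standing for \<open>a1 \<otimes> b1 + ... + an \<otimes> bn\<close>, and equality of tensors is
  the relation \<open>teq\<close> below; thus list comprehensions are Sweedler sums.  A linear map into a
  tensor product is a function into lists that is linear up to \<open>teq\<close>; a linear map out of
  \<open>A \<otimes> B\<close> is a bilinear map on \<open>A\<close> and \<open>B\<close>.
\<close>

section \<open>Tensor products\<close>

text \<open>
  \<open>A \<otimes> B\<close> is the free commutative monoid on \<open>A \<times> B\<close> modulo the congruence generated by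
  bilinearity; it is automatically a vector space, with \<open>c(a \<otimes> b) = ca \<otimes> b = a \<otimes> cb\<close>.
\<close>

inductive teq :: "('k \<Rightarrow> 'a::ab_group_add \<Rightarrow> 'a) \<Rightarrow> ('k \<Rightarrow> 'b::ab_group_add \<Rightarrow> 'b)
    \<Rightarrow> ('a \<times> 'b) list \<Rightarrow> ('a \<times> 'b) list \<Rightarrow> bool"
  for sA sB where
  teq_refl: "teq sA sB xs xs"
| teq_sym: "teq sA sB xs ys \<Longrightarrow> teq sA sB ys xs"
| teq_trans: "teq sA sB xs ys \<Longrightarrow> teq sA sB ys zs \<Longrightarrow> teq sA sB xs zs"
| teq_append: "teq sA sB xs xs' \<Longrightarrow> teq sA sB ys ys' \<Longrightarrow> teq sA sB (xs @ ys) (xs' @ ys')"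
| teq_commute: "teq sA sB (xs @ ys) (ys @ xs)"
| teq_zero: "teq sA sB [(0, b)] []"
| teq_add_left: "teq sA sB [(a + a', b)] [(a, b), (a', b)]"
| teq_add_right: "teq sA sB [(a, b + b')] [(a, b), (a, b')]"
| teq_scale: "teq sA sB [(sA c a, b)] [(a, sB c b)]"

inductive teq3 :: "('k \<Rightarrow> 'a::ab_group_add \<Rightarrow> 'a) \<Rightarrow> ('k \<Rightarrow> 'b::ab_group_add \<Rightarrow> 'b)
    \<Rightarrow> ('k \<Rightarrow> 'c::ab_group_add \<Rightarrow> 'c) \<Rightarrow> ('a \<times> 'b \<times> 'c) list \<Rightarrow> ('a \<times> 'b \<times> 'c) list \<Rightarrow> bool"
  for sA sB sC where
  teq3_refl: "teq3 sA sB sC xs xs"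
| teq3_sym: "teq3 sA sB sC xs ys \<Longrightarrow> teq3 sA sB sC ys xs"
| teq3_trans: "teq3 sA sB sC xs ys \<Longrightarrow> teq3 sA sB sC ys zs \<Longrightarrow> teq3 sA sB sC xs zs"
| teq3_append: "teq3 sA sB sC xs xs' \<Longrightarrow> teq3 sA sB sC ys ys'
    \<Longrightarrow> teq3 sA sB sC (xs @ ys) (xs' @ ys')"
| teq3_commute: "teq3 sA sB sC (xs @ ys) (ys @ xs)"
| teq3_zero: "teq3 sA sB sC [(0, b, c)] []"
| teq3_add_1: "teq3 sA sB sC [(a + a', b, c)] [(a, b, c), (a', b, c)]"
| teq3_add_2: "teq3 sA sB sC [(a, b + b', c)] [(a, b, c), (a, b', c)]"
| teq3_add_3: "teq3 sA sB sC [(a, b, c + c')] [(a, b, c), (a, b, c')]"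
| teq3_scale_12: "teq3 sA sB sC [(sA k a, b, c)] [(a, sB k b, c)]"
| teq3_scale_23: "teq3 sA sB sC [(a, sB k b, c)] [(a, b, sC k c)]"

definition tlinear :: "('k \<Rightarrow> 'v::ab_group_add \<Rightarrow> 'v) \<Rightarrow> ('k \<Rightarrow> 'a::ab_group_add \<Rightarrow> 'a)
    \<Rightarrow> ('k \<Rightarrow> 'b::ab_group_add \<Rightarrow> 'b) \<Rightarrow> ('v \<Rightarrow> ('a \<times> 'b) list) \<Rightarrow> bool" where
  "tlinear sV sA sB f \<longleftrightarrow>
    (\<forall>u v. teq sA sB (f (u + v)) (f u @ f v)) \<and>
    (\<forall>c v. teq sA sB (f (sV c v)) [(sA c a, b). (a, b) \<leftarrow> f v])"

definition k_bilinear :: "('k::field \<Rightarrow> 'a::ab_group_add \<Rightarrow> 'a) \<Rightarrow> ('k \<Rightarrow> 'b::ab_group_add \<Rightarrow> 'b)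
    \<Rightarrow> ('k \<Rightarrow> 'c::ab_group_add \<Rightarrow> 'c) \<Rightarrow> ('a \<Rightarrow> 'b \<Rightarrow> 'c) \<Rightarrow> bool" where
  "k_bilinear sA sB sC f \<longleftrightarrow>
    (\<forall>a. Vector_Spaces.linear sB sC (f a)) \<and> (\<forall>b. Vector_Spaces.linear sA sC (\<lambda>a. f a b))"


section \<open>Coalgebras and Hopf algebras\<close>

locale coalgebra = vector_space s
  for s :: "'k::field \<Rightarrow> 'c::ab_group_add \<Rightarrow> 'c" +
  fixes \<delta> :: "'c \<Rightarrow> ('c \<times> 'c) list" and \<epsilon> :: "'c \<Rightarrow> 'k"
  assumes comult_linear: "tlinear s s s \<delta>"
    and counit_linear: "Vector_Spaces.linear s (*) \<epsilon>"
    and coassoc: "teq3 s s s [(c11, c12, c2). (c1, c2) \<leftarrow> \<delta> c, (c11, c12) \<leftarrow> \<delta> c1]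
                             [(c1, c21, c22). (c1, c2) \<leftarrow> \<delta> c, (c21, c22) \<leftarrow> \<delta> c2]"
    and counit_left: "(\<Sum>(c1, c2)\<leftarrow>\<delta> c. s (\<epsilon> c1) c2) = c"
    and counit_right: "(\<Sum>(c1, c2)\<leftarrow>\<delta> c. s (\<epsilon> c2) c1) = c"
begin

definition subcoalgebra :: "'c set \<Rightarrow> bool" where
  "subcoalgebra D \<longleftrightarrow>
    subspace D \<and> (\<forall>c\<in>D. \<exists>xs. set xs \<subseteq> D \<times> D \<and> teq s s (\<delta> c) xs)"

definition simple_subcoalgebra :: "'c set \<Rightarrow> bool" where
  "simple_subcoalgebra D \<longleftrightarrow>
    subcoalgebra D \<and> D \<noteq> {0} \<and> (\<forall>E. subcoalgebra E \<and> E \<subseteq> D \<longrightarrow> E = {0} \<or> E = D)"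

definition coradical :: "'c set" where
  "coradical = span (\<Union>{D. simple_subcoalgebra D})"

text \<open>Primitive elements with respect to a distinguished group-like element \<open>e\<close>.\<close>

definition primitives :: "'c \<Rightarrow> 'c set" where
  "primitives e = {c. teq s s (\<delta> c) [(c, e), (e, c)]}"

definition thin :: "'c \<Rightarrow> bool" where
  "thin e \<longleftrightarrow> dim coradical = 1 \<and> dim (primitives e) = 1"

end

locale hopf_algebra = coalgebra sH \<Delta> \<epsilon>H
  for sH :: "'k::field \<Rightarrow> 'h::ring_1 \<Rightarrow> 'h" and \<Delta> and \<epsilon>H +
  fixes S :: "'h \<Rightarrow> 'h"
  assumes mult_bilinear: "k_bilinear sH sH sH (*)"
    and comult_one: "teq sH sH (\<Delta> 1) [(1, 1)]"
    and comult_mult: "teq sH sH (\<Delta> (h * k)) [(h1 * k1, h2 * k2). (h1, h2) \<leftarrow> \<Delta> h, (k1, k2) \<leftarrow> \<Delta> k]"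
    and counit_one: "\<epsilon>H 1 = 1"
    and counit_mult: "\<epsilon>H (h * k) = \<epsilon>H h * \<epsilon>H k"
    and antipode_linear: "Vector_Spaces.linear sH sH S"
    and antipode_left: "(\<Sum>(h1, h2)\<leftarrow>\<Delta> h. S h1 * h2) = sH (\<epsilon>H h) 1"
    and antipode_right: "(\<Sum>(h1, h2)\<leftarrow>\<Delta> h. h1 * S h2) = sH (\<epsilon>H h) 1"
begin

definition grouplike :: "'h \<Rightarrow> bool" where
  "grouplike g \<longleftrightarrow> teq sH sH (\<Delta> g) [(g, g)] \<and> \<epsilon>H g = 1"

definition character :: "('h \<Rightarrow> 'k) \<Rightarrow> bool" where
  "character \<chi> \<longleftrightarrow>
    Vector_Spaces.linear sH (*) \<chi> \<and> \<chi> 1 = 1 \<and> (\<forall>h k. \<chi> (h * k) = \<chi> h * \<chi> k)"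

primrec conv_power :: "('h \<Rightarrow> 'k) \<Rightarrow> nat \<Rightarrow> 'h \<Rightarrow> 'k" where
  "conv_power \<chi> 0 h = \<epsilon>H h"
| "conv_power \<chi> (Suc n) h = (\<Sum>(h1, h2)\<leftarrow>\<Delta> h. \<chi> h1 * conv_power \<chi> n h2)"

definition yd_datum :: "'h \<Rightarrow> ('h \<Rightarrow> 'k) \<Rightarrow> 'k \<Rightarrow> bool" where
  "yd_datum g \<chi> q \<longleftrightarrow>
    grouplike g \<and> character \<chi> \<and> \<chi> g = q \<and>
    (\<forall>h. g * (\<Sum>(h1, h2)\<leftarrow>\<Delta> h. sH (\<chi> h1) h2) = (\<Sum>(h1, h2)\<leftarrow>\<Delta> h. sH (\<chi> h2) h1) * g)"

end

definition primitive_unity_root :: "nat \<Rightarrow> 'k::field \<Rightarrow> bool" where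
  "primitive_unity_root \<theta> q \<longleftrightarrow> 0 < \<theta> \<and> q ^ \<theta> = 1 \<and> (\<forall>k. 0 < k \<and> k < \<theta> \<longrightarrow> q ^ k \<noteq> 1)"

definition qint :: "'k::field \<Rightarrow> nat \<Rightarrow> 'k" where
  "qint q n = (\<Sum>i<n. q ^ i)"

definition qfact :: "'k::field \<Rightarrow> nat \<Rightarrow> 'k" where
  "qfact q n = (\<Prod>i=1..n. qint q i)"


section \<open>Yetter--Drinfeld modules, pre-bialgebras and cocycles\<close>

locale yetter_drinfeld =
  H: hopf_algebra sH \<Delta> \<epsilon>H S + V: vector_space sV
  for sH :: "'k::field \<Rightarrow> 'h::ring_1 \<Rightarrow> 'h" and \<Delta> and \<epsilon>H and S
    and sV :: "'k \<Rightarrow> 'v::ab_group_add \<Rightarrow> 'v" +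
  fixes act :: "'h \<Rightarrow> 'v \<Rightarrow> 'v" (infixr \<open>\<rhd>\<close> 75)
    and \<rho> :: "'v \<Rightarrow> ('h \<times> 'v) list"
  assumes act_bilinear: "k_bilinear sH sV sV (\<rhd>)"
    and act_one: "1 \<rhd> v = v"
    and act_mult: "(h * k) \<rhd> v = h \<rhd> (k \<rhd> v)"
    and coact_linear: "tlinear sV sH sV \<rho>"
    and coact_coassoc: "teq3 sH sH sV [(x1, x2, v0). (x, v0) \<leftarrow> \<rho> v, (x1, x2) \<leftarrow> \<Delta> x]
                                      [(x, y, v00). (x, v0) \<leftarrow> \<rho> v, (y, v00) \<leftarrow> \<rho> v0]"
    and coact_counit: "(\<Sum>(x, v0)\<leftarrow>\<rho> v. sV (\<epsilon>H x) v0) = v"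
    and yd_compat: "teq sH sV (\<rho> (h \<rhd> v))
      [(h1 * x * S h3, h2 \<rhd> v0). (h1, h') \<leftarrow> \<Delta> h, (h2, h3) \<leftarrow> \<Delta> h', (x, v0) \<leftarrow> \<rho> v]"
begin

definition coact2 :: "'v \<Rightarrow> 'v \<Rightarrow> ('h \<times> 'v \<times> 'v) list" where
  "coact2 v w = [(x * y, v0, w0). (x, v0) \<leftarrow> \<rho> v, (y, w0) \<leftarrow> \<rho> w]"

end

locale yd_coalgebra =
  R: coalgebra sR \<delta> \<epsilon> + yetter_drinfeld sH \<Delta> \<epsilon>H S sR act \<rho>
  for sH :: "'k::field \<Rightarrow> 'h::ring_1 \<Rightarrow> 'h" and \<Delta> and \<epsilon>H and S
    and sR :: "'k \<Rightarrow> 'r::ab_group_add \<Rightarrow> 'r"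
    and act (infixr \<open>\<rhd>\<close> 75) and \<rho> and \<delta> and \<epsilon> +
  assumes comult_act: "teq sR sR (\<delta> (h \<rhd> r))
      [(h1 \<rhd> r1, h2 \<rhd> r2). (h1, h2) \<leftarrow> \<Delta> h, (r1, r2) \<leftarrow> \<delta> r]"
    and counit_act: "\<epsilon> (h \<rhd> r) = \<epsilon>H h * \<epsilon> r"
    and comult_coact: "teq3 sH sR sR
      [(x, r1, r2). (x, r0) \<leftarrow> \<rho> r, (r1, r2) \<leftarrow> \<delta> r0]
      [(x, r10, r20). (r1, r2) \<leftarrow> \<delta> r, (x, r10, r20) \<leftarrow> coact2 r1 r2]"
    and counit_coact: "(\<Sum>(x, r0)\<leftarrow>\<rho> r. sH (\<epsilon> r0) x) = sH (\<epsilon> r) 1"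
begin

text \<open>The braided comultiplication \<open>\<delta>\<^bsub>R\<otimes>R\<^esub>(r \<otimes> s)\<close>, a sum of \<open>(a \<otimes> b) \<otimes> (c \<otimes> d)\<close>.\<close>

definition comult2 :: "'r \<Rightarrow> 'r \<Rightarrow> (('r \<times> 'r) \<times> ('r \<times> 'r)) list" where
  "comult2 r s = [((r1, x \<rhd> s1), (r20, s2)).
      (r1, r2) \<leftarrow> \<delta> r, (x, r20) \<leftarrow> \<rho> r2, (s1, s2) \<leftarrow> \<delta> s]"

definition associated_datum :: "'r \<Rightarrow> 'h \<Rightarrow> ('h \<Rightarrow> 'k) \<Rightarrow> bool" where
  "associated_datum y g \<chi> \<longleftrightarrow>
    H.yd_datum g \<chi> (\<chi> g) \<and>
    (\<exists>\<theta>. 2 \<le> \<theta> \<and> \<theta> \<le> R.dim UNIV \<and> primitive_unity_root \<theta> (\<chi> g)) \<and>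
    teq sH sR (\<rho> y) [(g, y)] \<and> (\<forall>h. h \<rhd> y = sR (\<chi> h) y)"

end

locale pre_bialgebra =
  yd_coalgebra sH \<Delta> \<epsilon>H S sR act \<rho> \<delta> \<epsilon>
  for sH :: "'k::field \<Rightarrow> 'h::ring_1 \<Rightarrow> 'h" and \<Delta> and \<epsilon>H and S
    and sR :: "'k \<Rightarrow> 'r::ab_group_add \<Rightarrow> 'r"
    and act (infixr \<open>\<rhd>\<close> 75) and \<rho> and \<delta> and \<epsilon> +
  fixes m :: "'r \<Rightarrow> 'r \<Rightarrow> 'r" and u :: "'k \<Rightarrow> 'r"
  assumes m_bilinear: "k_bilinear sR sR sR m"
    and u_linear: "Vector_Spaces.linear (*) sR u"
    and act_unit: "h \<rhd> u 1 = sR (\<epsilon>H h) (u 1)"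
    and coact_unit: "teq sH sR (\<rho> (u 1)) [(1, u 1)]"
    and comult_unit: "teq sR sR (\<delta> (u 1)) [(u 1, u 1)]"
    and counit_unit: "\<epsilon> (u 1) = 1"
    and act_m: "h \<rhd> m r s = (\<Sum>(h1, h2)\<leftarrow>\<Delta> h. m (h1 \<rhd> r) (h2 \<rhd> s))"
    and comult_m: "teq sR sR (\<delta> (m r s)) [(m a b, m c d). ((a, b), (c, d)) \<leftarrow> comult2 r s]"
    and counit_m: "\<epsilon> (m r s) = \<epsilon> r * \<epsilon> s"
    and m_unit_right: "m r (u 1) = r"
    and m_unit_left: "m (u 1) r = r"
begin

text \<open>\<open>m\<close> is not assumed associative; powers are bracketed to the right.\<close>

primrec power_R :: "'r \<Rightarrow> nat \<Rightarrow> 'r" where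
  "power_R r 0 = u 1"
| "power_R r (Suc n) = m r (power_R r n)"

definition divided_power_basis :: "nat \<Rightarrow> 'r \<Rightarrow> 'h \<Rightarrow> ('h \<Rightarrow> 'k) \<Rightarrow> (nat \<Rightarrow> 'r) \<Rightarrow> bool" where
  "divided_power_basis N y g \<chi> d \<longleftrightarrow>
    inj_on d {..<N} \<and> \<not> R.dependent (d ` {..<N}) \<and> R.span (d ` {..<N}) = UNIV \<and>
    d 0 = u 1 \<and> d 1 = y \<and>
    (\<forall>n<N. teq sR sR (\<delta> (d n)) [(d t, d (n - t)). t \<leftarrow> [0..<Suc n]]) \<and>
    (\<forall>n<N. g \<rhd> d n = sR (\<chi> g ^ n) (d n)) \<and>
    (\<forall>n<N. \<forall>h. h \<rhd> d n = sR (H.conv_power \<chi> n h) (d n)) \<and>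
    (\<forall>n. 1 \<le> n \<and> n \<le> N - 1 \<longrightarrow> m y (d (n - 1)) = sR (qint (\<chi> g) n) (d n))"

end

text \<open>
  The two sides of each identity are the given composites of linear maps, evaluated on
  pure tensors; \<open>((a, b), (c, d))\<close> always runs over \<open>\<delta>\<^bsub>R\<otimes>R\<^esub>\<close>.
\<close>

locale pre_bialgebra_cocycle =
  pre_bialgebra sH \<Delta> \<epsilon>H S sR act \<rho> \<delta> \<epsilon> m u
  for sH :: "'k::field \<Rightarrow> 'h::ring_1 \<Rightarrow> 'h" and \<Delta> and \<epsilon>H and S
    and sR :: "'k \<Rightarrow> 'r::ab_group_add \<Rightarrow> 'r"
    and act (infixr \<open>\<rhd>\<close> 75) and \<rho> and \<delta> and \<epsilon> and m and u +
  fixes \<xi> :: "'r \<Rightarrow> 'r \<Rightarrow> 'h"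
  assumes xi_bilinear: "k_bilinear sR sR sH \<xi>"
    and xi_act: "(\<Sum>(h1, h2)\<leftarrow>\<Delta> h. \<xi> (h1 \<rhd> r) (h2 \<rhd> s)) = (\<Sum>(h1, h2)\<leftarrow>\<Delta> h. h1 * \<xi> r s * S h2)"
    and comult_xi: "teq sH sH (\<Delta> (\<xi> r s))
      [(\<xi> a b * x, \<xi> c0 d0). ((a, b), (c, d)) \<leftarrow> comult2 r s, (x, c0, d0) \<leftarrow> coact2 c d]"
    and counit_xi: "\<epsilon>H (\<xi> r s) = \<epsilon> r * \<epsilon> s"
    and coact_m_xi: "teq sH sR
      [(x * \<xi> c d, p0). ((a, b), (c, d)) \<leftarrow> comult2 r s, (x, p0) \<leftarrow> \<rho> (m a b)]
      [(\<xi> a b * x, m c0 d0). ((a, b), (c, d)) \<leftarrow> comult2 r s, (x, c0, d0) \<leftarrow> coact2 c d]"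
    and m_assoc_xi: "m r (m s t) =
      (\<Sum>((a, b), (c, d))\<leftarrow>comult2 r s. m (m a b) (\<xi> c d \<rhd> t))"
    and xi_cocycle:
      "(\<Sum>((a, b), (c, d))\<leftarrow>comult2 s t. \<xi> r (m a b) * \<xi> c d) =
       (\<Sum>((a, b), (c, d))\<leftarrow>comult2 r s. \<Sum>(x1, x2)\<leftarrow>\<Delta> (\<xi> c d). \<xi> (m a b) (x1 \<rhd> t) * x2)"
    and xi_unit_right: "\<xi> r (u 1) = sH (\<epsilon> r) 1"
    and xi_unit_left: "\<xi> (u 1) r = sH (\<epsilon> r) 1"
begin

definition m_tilde :: "'r \<Rightarrow> 'r \<Rightarrow> ('r \<times> 'h) list" where
  "m_tilde r s = [(m a b, \<xi> c d). ((a, b), (c, d)) \<leftarrow> comult2 r s]"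

text \<open>Multiplication and powers in \<open>R #\<^sub>\<xi> H\<close>, whose underlying space is \<open>R \<otimes> H\<close>.\<close>

definition smash_mult :: "('r \<times> 'h) list \<Rightarrow> ('r \<times> 'h) list \<Rightarrow> ('r \<times> 'h) list" where
  "smash_mult X Z = [(p, x * h2 * k).
      (r, h) \<leftarrow> X, (s, k) \<leftarrow> Z, (h1, h2) \<leftarrow> \<Delta> h, (p, x) \<leftarrow> m_tilde r (h1 \<rhd> s)]"

primrec smash_power :: "('r \<times> 'h) list \<Rightarrow> nat \<Rightarrow> ('r \<times> 'h) list" where
  "smash_power X 0 = [(u 1, 1)]"
| "smash_power X (Suc n) = smash_mult X (smash_power X n)"

end

end

theory Submission
  imports Defs
begin

text \<open>
  Write \<open>\<xi>\<^sub>i\<^sub>j = \<xi>(d\<^sub>i \<otimes> d\<^sub>j)\<close>, an element of degree \<open>i + j\<close>.  The whole statement comes from one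
  rigidity property of degrees: \<open>\<xi>\<^sub>i\<^sub>j = 0\<close> unless \<open>N\<close> divides \<open>2(i + j)\<close>, so only the degrees
  \<open>0\<close>, \<open>N/2\<close>, \<open>N\<close>, \<open>3N/2\<close> survive (\<open>xi_d_eq_0\<close>).  Two computations of the conjugate of \<open>\<xi>\<^sub>i\<^sub>j\<close> by
  \<open>g\<close> are compared.  Compatibility of \<open>\<xi>\<close> with the action gives
  \<open>g \<xi>\<^sub>i\<^sub>j = q\<^sup>i\<^sup>+\<^sup>j \<xi>\<^sub>i\<^sub>j g\<close>.  On the other hand \<open>\<Sum> \<chi>(h\<^sub>1) h\<^sub>2 = q\<^sup>i\<^sup>+\<^sup>j h\<close> and \<open>\<Sum> h\<^sub>1 \<chi>(h\<^sub>2) = h\<close> for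
  \<open>h = \<xi>\<^sub>i\<^sub>j\<close>, so the defining relation of a Yetter--Drinfeld datum reads
  \<open>q\<^sup>i\<^sup>+\<^sup>j g \<xi>\<^sub>i\<^sub>j = \<xi>\<^sub>i\<^sub>j g\<close>.  Hence \<open>q\<close> to the power \<open>2(i + j)\<close> fixes \<open>\<xi>\<^sub>i\<^sub>j\<close>.

  Once the degrees are known, evaluate the cocycle identity at \<open>y \<otimes> y\<^sup>b \<otimes> y\<^sup>c\<close>.  Each side is
  one main term, \<open>\<xi>(y \<otimes> y\<^sup>b\<^sup>+\<^sup>c)\<close> respectively \<open>\<xi>(y\<^sup>b\<^sup>+\<^sup>1 \<otimes> y\<^sup>c)\<close>, plus products of two values of
  \<open>\<xi>\<close> in positive degrees.  In degree \<open>N/2\<close> there are no such products; in degree \<open>N\<close> both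
  factors have degree \<open>N/2\<close> and so are multiples of \<open>x\<close>; in degree \<open>3N/2\<close> one factor has degree
  \<open>N/2\<close>.  So the main terms agree under the respective hypotheses (\<open>xi_y_pow_shift\<close>), and in
  degree \<open>3N/2\<close> the common value is \<open>0\<close> because \<open>y\<^sup>N = 0\<close>.

  For \<open>Y\<^sup>N\<close>, left multiplication by \<open>Y\<close> is written in coordinates along the basis of \<open>R\<close>
  (\<open>smash_coord_y_mult\<close>).  With \<open>M = N/2\<close>, the power \<open>Y\<^sup>n\<close> for \<open>n < N\<close> is
  \<open>(n)\<^sub>q! d\<^sub>n \<otimes> 1 + (n)\<^sub>q!/(M)\<^sub>q d\<^sub>n\<^sub>-\<^sub>M \<otimes> x\<close>; the factor \<open>(n)\<^sub>q!\<close> is \<open>0\<close> at \<open>n = N\<close>, and the only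
  survivor is the new term \<open>1 \<otimes> \<xi>(y \<otimes> y\<^sup>N\<^sup>-\<^sup>1)\<close>.

  All this rests on the structure of \<open>R\<close>.  The coaction on \<open>d\<^sub>n\<close> is not diagonal in general, but
  its matrix is triangular with diagonal entries \<open>g\<^sup>n\<close>, and an off-diagonal entry \<open>c\<close> satisfies
  \<open>g c = q\<^sup>k c g\<close> with \<open>0 < k\<close> smaller than the order of \<open>q\<close>; every character with nonzero value
  at \<open>g\<close> kills such a \<open>c\<close> (\<open>conv_power_weight\<close>).  Therefore \<open>\<delta>\<^bsub>R\<otimes>R\<^esub>\<close> is given on the basis by
  the formula for a diagonal coaction (\<open>sum_comult2_d\<close>), and \<open>R\<close> is a truncated quantum line.
  That \<open>q\<close> has order exactly \<open>N\<close> (\<open>theta_eq_N\<close>) uses characteristic \<open>0\<close>: if the order \<open>\<theta>\<close> were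
  smaller, \<open>d\<^sub>\<theta>\<close> would behave like the generator of an ordinary divided power algebra, which
  is infinite-dimensional.
\<close>

section \<open>Linear maps out of tensor products\<close>

text \<open>Tensors are lists up to \<open>teq\<close>; they are handled by evaluating bilinear maps on them.
  The rules of this section build the required linear maps compositionally, so that linearity
  of a Sweedler sum in one of its arguments is proved by \<open>intro\<close>.\<close>

abbreviation lin :: "('k::field \<Rightarrow> 'a::ab_group_add \<Rightarrow> 'a) \<Rightarrow> ('k \<Rightarrow> 'b::ab_group_add \<Rightarrow> 'b)
    \<Rightarrow> ('a \<Rightarrow> 'b) \<Rightarrow> bool" where
  "lin \<equiv> Vector_Spaces.linear"

lemmas lin_iff = Vector_Spaces.linear_iff

lemma k_bilinearI:
  assumes "\<And>a. lin sB sC (\<lambda>b. f a b)" and "\<And>b. lin sA sC (\<lambda>a. f a b)"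
  shows "k_bilinear sA sB sC f"
  using assms by (auto simp: k_bilinear_def)

lemma lin_ident: "vector_space s \<Longrightarrow> lin s s (\<lambda>v. v)"
  by (simp add: lin_iff)

lemma lin_compose: "lin sB sC f \<Longrightarrow> lin sA sB F \<Longrightarrow> lin sA sC (\<lambda>v. f (F v))"
  by (simp add: lin_iff)

lemma lin_bilinear_left:
  assumes "k_bilinear sA sB sC f" "lin sV sA F"
  shows "lin sV sC (\<lambda>v. f (F v) b)"
  by (rule lin_compose[OF _ assms(2)]) (use assms(1) in \<open>auto simp: k_bilinear_def\<close>)

lemma lin_bilinear_right:
  assumes "k_bilinear sA sB sC f" "lin sV sB F"
  shows "lin sV sC (\<lambda>v. f a (F v))"
  by (rule lin_compose[OF _ assms(2)]) (use assms(1) in \<open>auto simp: k_bilinear_def\<close>)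

lemma k_bilinear_scale: "vector_space s \<Longrightarrow> k_bilinear (*) s s s"
  by (rule k_bilinearI) (auto simp: lin_iff vector_space_def algebra_simps)

lemma k_bilinear_zero_left:
  assumes "k_bilinear sA sB sC f"
  shows "f 0 b = 0"
proof -
  have "f (0 + 0) b = f 0 b + f 0 b"
    using assms unfolding k_bilinear_def lin_iff by blast
  then show ?thesis by simp
qed

lemma sum_list_concat_map:
  "sum_list (map f (concat (map F xs))) = (\<Sum>x\<leftarrow>xs. sum_list (map f (F x)))"
  by (induction xs) auto

lemma sum_list_mult:
  fixes f f' :: "_ \<Rightarrow> _ \<Rightarrow> 'z::semiring_0"
  shows "(\<Sum>(a, b)\<leftarrow>xs. f a b) * (\<Sum>(a, b)\<leftarrow>ys. f' a b)
   = (\<Sum>(a, b)\<leftarrow>xs. \<Sum>(a', b')\<leftarrow>ys. f a b * f' a' b')"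
proof -
  have *: "z * (\<Sum>(a, b)\<leftarrow>ys. f' a b) = (\<Sum>(a, b)\<leftarrow>ys. z * f' a b)" for z
    by (induction ys) (auto simp: distrib_left)
  show ?thesis
    by (induction xs) (auto simp: distrib_right *[symmetric])
qed

lemma scale_sum_list: "lin sA sB f \<Longrightarrow> f (\<Sum>(a, b)\<leftarrow>xs. F a b) = (\<Sum>(a, b)\<leftarrow>xs. f (F a b))"
proof -
  assume "lin sA sB f"
  then interpret Vector_Spaces.linear sA sB f .
  show ?thesis by (induction xs) (auto simp: add)
qed

lemma sum_list_swap: "(\<Sum>(a, b)\<leftarrow>xs. \<Sum>j\<in>J. F a b j) = (\<Sum>j\<in>J. \<Sum>(a, b)\<leftarrow>xs. F a b j)"
  for F :: "_ \<Rightarrow> _ \<Rightarrow> _ \<Rightarrow> 'z::comm_monoid_add"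
  by (induction xs) (auto simp: sum.distrib)

lemma lin_sum_list:
  assumes "vector_space sV" "vector_space sZ" "\<And>a b. lin sV sZ (\<lambda>v. f a b v)"
  shows "lin sV sZ (\<lambda>v. \<Sum>(a, b)\<leftarrow>xs. f a b v)"
proof -
  interpret V: vector_space sV by fact
  interpret Z: vector_space sZ by fact
  have f: "f a b (v + w) = f a b v + f a b w" "f a b (sV c v) = sZ c (f a b v)" for a b c v w
    using assms(3) by (auto simp: lin_iff)
  show ?thesis
    by (induction xs)
      (auto simp: lin_iff assms f V.vector_space_axioms Z.vector_space_axioms algebra_simps)
qed

lemma lin_sum:
  assumes "vector_space sV" "vector_space sZ" "\<And>i. i \<in> I \<Longrightarrow> lin sV sZ (\<lambda>v. f i v)"
  shows "lin sV sZ (\<lambda>v. \<Sum>i\<in>I. f i v)"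
proof -
  interpret Z: vector_space sZ by fact
  have f: "f i (v + w) = f i v + f i w" "f i (sV c v) = sZ c (f i v)" if "i \<in> I" for i c v w
    using assms(3)[OF that] by (auto simp: lin_iff)
  show ?thesis
    by (simp add: lin_iff assms f sum.distrib Z.scale_sum_right)
qed

text \<open>The easy half of the universal property of \<open>A \<otimes> B\<close>: each generating relation of
  \<open>teq\<close> is respected by a bilinear map.\<close>

lemma teq_sum:
  assumes "teq sA sB xs ys" "k_bilinear sA sB sZ f"
  shows "(\<Sum>(a, b)\<leftarrow>xs. f a b) = (\<Sum>(a, b)\<leftarrow>ys. f a b)"
proof -
  have add: "f (a + a') b = f a b + f a' b" "f a (b + b') = f a b + f a b'"
      "f (sA c a) b = f a (sB c b)" for a a' b b' c
    using assms(2) by (auto simp: k_bilinear_def lin_iff)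
  have zero: "f 0 b = 0" for b by (rule k_bilinear_zero_left[OF assms(2)])
  from assms(1) show ?thesis
    by induction (auto simp: add zero add.commute)
qed

lemma teq3_sum:
  assumes "teq3 sA sB sC xs ys"
    and "\<And>b c. lin sA sZ (\<lambda>a. f a b c)" "\<And>a c. lin sB sZ (\<lambda>b. f a b c)"
      "\<And>a b. lin sC sZ (\<lambda>c. f a b c)"
  shows "(\<Sum>(a, b, c)\<leftarrow>xs. f a b c) = (\<Sum>(a, b, c)\<leftarrow>ys. f a b c)"
proof -
  have add: "f (a + a') b c = f a b c + f a' b c" "f a (b + b') c = f a b c + f a b' c"
      "f a b (c + c') = f a b c + f a b c'"
      "f (sA k a) b c = f a (sB k b) c" "f a (sB k b) c = f a b (sC k c)" for a a' b b' c c' k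
    using assms(2-) by (auto simp: lin_iff)
  have zero: "f 0 b c = 0" for b c using add(1)[of 0 0 b c] by simp
  from assms(1) show ?thesis
    by induction (auto simp: add zero add.commute)
qed

lemma lin_sum_tlinear:
  assumes D: "tlinear sU sA sB D" and F: "lin sV sU F" and f: "k_bilinear sA sB sZ f"
  shows "lin sV sZ (\<lambda>v. \<Sum>(a, b)\<leftarrow>D (F v). f a b)"
proof -
  from f have "vector_space sZ" by (auto simp: k_bilinear_def lin_iff)
  then interpret Z: vector_space sZ .
  have "lin sB sZ (f a)" "lin sA sZ (\<lambda>a. f a b)" for a b
    using f by (auto simp: k_bilinear_def)
  then have sc: "f (sA c a) b = sZ c (f a b)" for a b c
    by (auto simp: lin_iff)
  have hom: "(\<Sum>(a, b)\<leftarrow>xs. sZ c (f a b)) = sZ c (\<Sum>(a, b)\<leftarrow>xs. f a b)" for c xs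
    by (induction xs) (auto simp: Z.scale_right_distrib)
  have vs: "vector_space sV" "vector_space sU" using F by (auto simp: lin_iff)
  have "(\<Sum>(a, b)\<leftarrow>D (v + w). f a b) = (\<Sum>(a, b)\<leftarrow>D v. f a b) + (\<Sum>(a, b)\<leftarrow>D w. f a b)" for v w
    using D teq_sum[OF _ f, of "D (v + w)" "D v @ D w"] by (auto simp: tlinear_def)
  moreover have "(\<Sum>(a, b)\<leftarrow>D (sU c v). f a b) = sZ c (\<Sum>(a, b)\<leftarrow>D v. f a b)" for c v
  proof -
    have "(\<Sum>(a, b)\<leftarrow>D (sU c v). f a b) = (\<Sum>(a, b)\<leftarrow>[(sA c a, b). (a, b) \<leftarrow> D v]. f a b)"
      by (rule teq_sum[OF _ f]) (use D in \<open>simp add: tlinear_def\<close>)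
    also have "\<dots> = (\<Sum>(a, b)\<leftarrow>D v. sZ c (f a b))"
      by (simp add: case_prod_unfold comp_def sc)
    also have "\<dots> = sZ c (\<Sum>(a, b)\<leftarrow>D v. f a b)"
      by (rule hom)
    finally show ?thesis .
  qed
  ultimately have "lin sU sZ (\<lambda>v. \<Sum>(a, b)\<leftarrow>D v. f a b)"
    by (simp add: lin_iff vs Z.vector_space_axioms)
  then show ?thesis by (rule lin_compose) (rule F)
qed

lemma teq_Cons: "teq sA sB [x] [y] \<Longrightarrow> teq sA sB xs ys \<Longrightarrow> teq sA sB (x # xs) (y # ys)"
  using teq_append[of sA sB "[x]" "[y]" xs ys] by simp

lemma teq_map_cong:
  "(\<And>x. x \<in> set xs \<Longrightarrow> teq sA sB [F x] [G x]) \<Longrightarrow> teq sA sB (map F xs) (map G xs)"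
  by (induction xs) (auto intro: teq_refl teq_Cons)

lemma teq_sum_left: "teq sA sB [(\<Sum>x\<leftarrow>xs. F x, b)] (map (\<lambda>x. (F x, b)) xs)"
proof (induction xs)
  case (Cons x xs)
  have "teq sA sB [(F x + (\<Sum>x\<leftarrow>xs. F x), b)] ([(F x, b)] @ [(\<Sum>x\<leftarrow>xs. F x, b)])"
    using teq_add_left[of sA sB] by simp
  also note teq_append[OF teq_refl Cons.IH]
  finally (teq_trans) show ?case by simp
qed (simp add: teq_zero)

text \<open>Together with \<open>teq_sum_left\<close>, this brings a tensor into normal form with respect to
  a basis of the left factor.\<close>

lemma teq_map_add:
  "teq sA sB (map (\<lambda>x. (F x, G x)) xs @ map (\<lambda>x. (F x, G' x)) xs) (map (\<lambda>x. (F x, G x + G' x)) xs)"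
proof (induction xs)
  case (Cons x xs)
  let ?M = "map (\<lambda>x. (F x, G x)) xs" and ?M' = "map (\<lambda>x. (F x, G' x)) xs"
  have "teq sA sB ([(F x, G x)] @ (?M @ [(F x, G' x)]) @ ?M') ([(F x, G x)] @ ([(F x, G' x)] @ ?M) @ ?M')"
    by (intro teq_append teq_refl teq_commute)
  also have "teq sA sB \<dots> ([(F x, G x + G' x)] @ (?M @ ?M'))"
    using teq_append[OF teq_sym[OF teq_add_right[of sA sB "F x" "G x" "G' x"]] teq_refl[of sA sB "?M @ ?M'"]] by simp
  also (teq_trans) have "teq sA sB \<dots> ([(F x, G x + G' x)] @ map (\<lambda>x. (F x, G x + G' x)) xs)"
    by (intro teq_append teq_refl Cons.IH)
  finally (teq_trans) show ?case by simp
qed (simp add: teq_refl)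

section \<open>Finite sums and q-integers\<close>

lemma double_sum_single:
  fixes f :: "nat \<Rightarrow> nat \<Rightarrow> 'z::comm_monoid_add"
  assumes "x \<le> a" "y \<le> b" "\<And>s t. s \<le> a \<Longrightarrow> t \<le> b \<Longrightarrow> (s, t) \<noteq> (x, y) \<Longrightarrow> f s t = 0"
  shows "(\<Sum>s\<le>a. \<Sum>t\<le>b. f s t) = f x y"
proof -
  have "(\<Sum>s\<le>a. \<Sum>t\<le>b. f s t) = (\<Sum>p\<in>{..a} \<times> {..b}. f (fst p) (snd p))"
    by (simp add: sum.cartesian_product case_prod_unfold)
  also have "\<dots> = (\<Sum>p\<in>{(x, y)}. f (fst p) (snd p))"
  proof (rule sum.mono_neutral_right)
    show "\<forall>p\<in>{..a} \<times> {..b} - {(x, y)}. f (fst p) (snd p) = 0"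
    proof
      fix p assume "p \<in> {..a} \<times> {..b} - {(x, y)}"
      then show "f (fst p) (snd p) = 0" using assms(3)[of "fst p" "snd p"] by auto
    qed
  qed (use assms(1,2) in auto)
  finally show ?thesis by simp
qed

lemma sum_indicator:
  fixes F :: "nat \<Rightarrow> nat \<Rightarrow> 'z::comm_monoid_add"
  assumes "a < N" "b < N"
  shows "(\<Sum>k<N. \<Sum>l<N. if k = a \<and> l = b then F k l else 0) = F a b"
proof -
  have "(\<Sum>k<N. \<Sum>l<N. if k = a \<and> l = b then F k l else 0) = (\<Sum>k<N. if k = a then \<Sum>l<N. if l = b then F a b else 0 else 0)"
    by (intro sum.cong) auto
  then show ?thesis using assms by simp
qed

lemma qint_Suc: "qint q (Suc n) = 1 + q * qint q n"
  by (simp only: qint_def sum.lessThan_Suc_shift) (simp add: sum_distrib_left)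

lemma qint_geometric: "(q - 1) * qint q n = q ^ n - 1"
  unfolding qint_def by (cases "q = 1") (simp_all add: geometric_sum)

lemma qint_add: "qint q (m + n) = qint q m + q ^ m * qint q n"
  by (induction n) (simp_all add: qint_def power_add algebra_simps)

lemma qfact_0 [simp]: "qfact q 0 = 1"
  by (simp add: qfact_def)

lemma qfact_Suc: "qfact q (Suc n) = qfact q n * qint q (Suc n)"
  by (simp add: qfact_def)

lemma qint_1 [simp]: "qint q (Suc 0) = 1" "qint q 0 = 0"
  by (simp_all add: qint_def)

lemma dvd_less_twice_eq:
  assumes "(n::nat) dvd k" "0 < k" "k < 2 * n"
  shows "k = n"
proof -
  obtain e where e: "k = n * e" using assms(1) by blast
  then have "n * e < n * 2" using assms(3) by simp
  then have "e < 2" by simp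
  moreover have "e \<noteq> 0" using e assms(2) by auto
  ultimately show ?thesis using e by (cases "e = 1") auto
qed

section \<open>The divided power basis\<close>

text \<open>The number \<open>\<theta>\<close> is the order of \<open>q\<close>; it is kept apart from \<open>N\<close> until the two are shown to
  agree.  The element \<open>y\<close> of the theorem is \<open>d 1\<close>.\<close>

locale divided_power_cocycle =
  pre_bialgebra_cocycle sH \<Delta> \<epsilon>H S sR act \<rho> \<delta> \<epsilon> m u \<xi>
  for sH :: "'k::field_char_0 \<Rightarrow> 'h::ring_1 \<Rightarrow> 'h" and \<Delta> and \<epsilon>H and S
    and sR :: "'k \<Rightarrow> 'r::ab_group_add \<Rightarrow> 'r"
    and act (infixr \<open>\<rhd>\<close> 75) and \<rho> and \<delta> and \<epsilon> and m and u and \<xi> +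
  fixes N \<theta> :: nat and g :: 'h and \<chi> :: "'h \<Rightarrow> 'k" and q :: 'k and d :: "nat \<Rightarrow> 'r"
  assumes datum: "H.yd_datum g \<chi> q"
    and root: "primitive_unity_root \<theta> q" and theta_ge: "2 \<le> \<theta>" and theta_le: "\<theta> \<le> N"
    and coact_y: "teq sH sR (\<rho> (d 1)) [(g, d 1)]"
    and basis: "divided_power_basis N (d 1) g \<chi> d"
begin

lemma chi_g: "\<chi> g = q" using datum by (simp add: H.yd_datum_def)

lemma N_ge: "2 \<le> N" "0 < N" "1 < N" "Suc 0 < N" using theta_ge theta_le by auto

lemma vs: "vector_space sH" "vector_space sR" "vector_space ((*) :: 'k \<Rightarrow> 'k \<Rightarrow> 'k)"
  by (fact H.vector_space_axioms, fact R.vector_space_axioms)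
    (unfold_locales, auto simp: algebra_simps)

lemma lin_chi: "lin sH (*) \<chi>" and chi_mult: "\<chi> (h * k) = \<chi> h * \<chi> k" and chi_one: "\<chi> 1 = 1"
  using datum by (auto simp: H.yd_datum_def H.character_def)

lemmas basis_unfolded = basis[unfolded divided_power_basis_def chi_g]

lemma inj_d: "inj_on d {..<N}" and independent_d: "R.independent (d ` {..<N})"
  and span_d: "R.span (d ` {..<N}) = UNIV" and d_0: "d 0 = u 1"
  using basis_unfolded by simp_all

lemma comult_d: "n < N \<Longrightarrow> teq sR sR (\<delta> (d n)) [(d t, d (n - t)). t \<leftarrow> [0..<Suc n]]"
  using basis_unfolded by (elim conjE) (erule allE, erule impE, assumption+)

lemma act_d: "n < N \<Longrightarrow> h \<rhd> d n = sR (H.conv_power \<chi> n h) (d n)"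
proof -
  assume n: "n < N"
  have "\<forall>n<N. \<forall>h. h \<rhd> d n = sR (H.conv_power \<chi> n h) (d n)"
    using basis_unfolded by (elim conjE)
  then show ?thesis using n by iprover
qed

lemma y_d:
  assumes "Suc n < N"
  shows "m (d 1) (d n) = sR (qint q (Suc n)) (d (Suc n))"
proof -
  have "1 \<le> k \<and> k \<le> N - 1 \<longrightarrow> m (d 1) (d (k - 1)) = sR (qint q k) (d k)" for k
    using basis_unfolded by (elim conjE) (erule allE, assumption)
  from this[of "Suc n"] show ?thesis using assms by simp
qed

text \<open>Beyond the dimension the coordinate is \<open>0\<close>, so that \<open>\<phi> (i + j)\<close> is the convolution
  product of \<open>\<phi> i\<close> and \<open>\<phi> j\<close> for all indices (lemma \<open>coord_comult\<close>).\<close>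

definition coord :: "nat \<Rightarrow> 'r \<Rightarrow> 'k" (\<open>\<phi>\<close>) where
  "\<phi> j v = (if j < N then R.representation (d ` {..<N}) v (d j) else 0)"

lemma lin_coord: "lin sR (*) (\<phi> j)"
proof (cases "j < N")
  case True
  have "lin sR (*) (\<lambda>v. R.representation (d ` {..<N}) v (d j))"
    by (rule R.linear_representation) (simp_all add: independent_d span_d)
  then show ?thesis using True unfolding coord_def[abs_def] by simp
qed (simp add: coord_def[abs_def] lin_iff vs)

lemma coord_d: "i < N \<Longrightarrow> \<phi> j (d i) = (if i = j then 1 else 0)"
proof -
  assume "i < N"
  then show ?thesis
    by (auto simp: coord_def R.representation_basis independent_d dest: inj_onD[OF inj_d])
qed

lemma expand: "v = (\<Sum>j<N. sR (\<phi> j v) (d j))"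
proof -
  have "v = (\<Sum>b\<in>d ` {..<N}. sR (R.representation (d ` {..<N}) v b) b)"
    by (rule R.sum_representation_eq[symmetric]) (auto simp: independent_d span_d)
  also have "\<dots> = (\<Sum>j<N. sR (\<phi> j v) (d j))"
    by (simp add: sum.reindex[OF inj_d] coord_def)
  finally show ?thesis .
qed

lemma eq_if_coord_eq: "(\<And>j. j < N \<Longrightarrow> \<phi> j v = \<phi> j w) \<Longrightarrow> v = w"
  using expand[of v] expand[of w] by (metis (no_types, lifting) lessThan_iff sum.cong)

lemma lin_expand:
  assumes "lin sR sZ f"
  shows "f v = (\<Sum>j<N. sZ (\<phi> j v) (f (d j)))"
proof -
  interpret f: Vector_Spaces.linear sR sZ f by fact
  show ?thesis by (subst (1) expand) (simp add: f.sum f.scale)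
qed

lemma lin_eqI:
  assumes "lin sR sZ f" "lin sR sZ f'" "\<And>n. n < N \<Longrightarrow> f (d n) = f' (d n)"
  shows "f v = f' v"
  using lin_expand[OF assms(1), of v] lin_expand[OF assms(2), of v] assms(3) by simp

lemmas lin_m = lin_bilinear_left[OF m_bilinear] lin_bilinear_right[OF m_bilinear]
lemmas lin_xi = lin_bilinear_left[OF xi_bilinear] lin_bilinear_right[OF xi_bilinear]
lemmas lin_act = lin_bilinear_left[OF act_bilinear] lin_bilinear_right[OF act_bilinear]
lemmas lin_mult_H = lin_bilinear_left[OF H.mult_bilinear] lin_bilinear_right[OF H.mult_bilinear]
lemmas lin_scale = k_bilinear_scale[OF vs(1), THEN lin_bilinear_left]
  k_bilinear_scale[OF vs(1), THEN lin_bilinear_right]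
  k_bilinear_scale[OF vs(2), THEN lin_bilinear_left]
  k_bilinear_scale[OF vs(2), THEN lin_bilinear_right]
  k_bilinear_scale[OF vs(3), THEN lin_bilinear_left]
  k_bilinear_scale[OF vs(3), THEN lin_bilinear_right]
lemmas lin_maps = lin_compose[OF lin_chi] lin_compose[OF lin_coord] lin_compose[OF R.counit_linear]
  lin_compose[OF H.counit_linear] lin_compose[OF H.antipode_linear]
lemmas lin_tensor = lin_sum_tlinear[OF R.comult_linear] lin_sum_tlinear[OF H.comult_linear]
  lin_sum_tlinear[OF coact_linear]

lemmas lin_intros_basic = lin_ident lin_sum_list lin_sum lin_m lin_xi lin_act lin_mult_H lin_scale
  lin_maps lin_tensor k_bilinearI vs

lemma lin_conv_power: "lin sH (*) (H.conv_power \<chi> n)"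
proof (induction n)
  case 0
  show ?case using H.counit_linear by (simp add: lin_iff)
next
  case (Suc n)
  show ?case unfolding H.conv_power.simps
    by (intro lin_intros_basic lin_compose[OF Suc])
qed

lemmas lin_intros = lin_intros_basic lin_compose[OF lin_conv_power]

lemma sum_comult_d:
  assumes "n < N" "k_bilinear sR sR sZ f"
  shows "(\<Sum>(a, b)\<leftarrow>\<delta> (d n). f a b) = (\<Sum>t\<le>n. f (d t) (d (n - t)))"
  by (subst teq_sum[OF comult_d[OF assms(1)] assms(2)])
    (simp add: comp_def interv_sum_list_conv_sum_set_nat atLeast0LessThan lessThan_Suc_atMost del: upt_Suc)

lemma sum_comult_g:
  assumes "k_bilinear sH sH sZ f"
  shows "(\<Sum>(a, b)\<leftarrow>\<Delta> g. f a b) = f g g"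
  by (subst teq_sum[OF _ assms, of _ "[(g, g)]"]) (use datum in \<open>auto simp: H.yd_datum_def H.grouplike_def\<close>)

lemma sum_comult_one:
  assumes "k_bilinear sH sH sZ f"
  shows "(\<Sum>(a, b)\<leftarrow>\<Delta> 1. f a b) = f 1 1"
  by (subst teq_sum[OF H.comult_one assms]) auto

lemma sum_comult_mult:
  assumes "k_bilinear sH sH sZ f"
  shows "(\<Sum>(a, b)\<leftarrow>\<Delta> (h * k). f a b) = (\<Sum>(h1, h2)\<leftarrow>\<Delta> h. \<Sum>(k1, k2)\<leftarrow>\<Delta> k. f (h1 * k1) (h2 * k2))"
  by (subst teq_sum[OF H.comult_mult assms]) (simp add: sum_list_concat_map case_prod_unfold comp_def)

text \<open>Like every convolution product of characters, \<open>\<chi>\<^sup>n\<close> is a character.\<close>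

lemma conv_power_one: "H.conv_power \<chi> n 1 = 1"
proof (induction n)
  case (Suc n)
  have "H.conv_power \<chi> (Suc n) 1 = \<chi> 1 * H.conv_power \<chi> n 1"
    unfolding H.conv_power.simps by (rule sum_comult_one[where sZ="(*)"]) (intro lin_intros)
  then show ?case using Suc by (simp add: chi_one)
qed (simp add: H.counit_one)

lemma conv_power_mult: "H.conv_power \<chi> n (h * k) = H.conv_power \<chi> n h * H.conv_power \<chi> n k"
proof (induction n arbitrary: h k)
  case (Suc n)
  have "H.conv_power \<chi> (Suc n) (h * k) = (\<Sum>(h1, h2)\<leftarrow>\<Delta> h. \<Sum>(k1, k2)\<leftarrow>\<Delta> k.
      \<chi> (h1 * k1) * H.conv_power \<chi> n (h2 * k2))"
    unfolding H.conv_power.simps by (rule sum_comult_mult[where sZ="(*)"]) (intro lin_intros)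
  then show ?case
    by (simp add: Suc chi_mult sum_list_mult mult.assoc mult.left_commute)
qed (simp add: H.counit_mult)

lemma conv_power_g: "H.conv_power \<chi> n g = q ^ n"
proof (induction n)
  case 0
  show ?case using datum by (simp add: H.yd_datum_def H.grouplike_def)
next
  case (Suc n)
  have "H.conv_power \<chi> (Suc n) g = \<chi> g * H.conv_power \<chi> n g"
    unfolding H.conv_power.simps by (rule sum_comult_g[where sZ="(*)"]) (intro lin_intros)
  then show ?case using Suc by (simp add: chi_g)
qed

lemma antipode_g: "S g * g = 1" "g * S g = 1"
proof -
  have e: "\<epsilon>H g = 1" using datum by (simp add: H.yd_datum_def H.grouplike_def)
  have "(\<Sum>(a, b)\<leftarrow>\<Delta> g. S a * b) = S g * g"
    by (rule sum_comult_g[where sZ=sH]) (intro lin_intros)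
  then show "S g * g = 1" by (simp add: H.antipode_left e)
  have "(\<Sum>(a, b)\<leftarrow>\<Delta> g. a * S b) = g * S g"
    by (rule sum_comult_g[where sZ=sH]) (intro lin_intros)
  then show "g * S g = 1" by (simp add: H.antipode_right e)
qed

lemma scale_mult_H [simp]: "sH c h * k = sH c (h * k)" "h * sH c k = sH c (h * k)"
  using H.mult_bilinear by (auto simp: k_bilinear_def lin_iff)

section \<open>The coaction on the divided power basis\<close>

text \<open>\<open>coact_coeff (d n)\<close> is row \<open>n\<close> of the matrix of the coaction.\<close>

definition coact_coeff :: "'r \<Rightarrow> nat \<Rightarrow> 'h" where
  "coact_coeff r j = (\<Sum>(x, v)\<leftarrow>\<rho> r. sH (\<phi> j v) x)"

lemma lin_coact_coeff: "lin sR sH (\<lambda>r. coact_coeff r j)"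
  unfolding coact_coeff_def by (intro lin_intros)

lemma sum_coact:
  assumes "k_bilinear sH sR sZ f"
  shows "(\<Sum>(x, v)\<leftarrow>\<rho> r. f x v) = (\<Sum>j<N. f (coact_coeff r j) (d j))"
proof -
  have *: "lin sR sZ (f x)" "lin sH sZ (\<lambda>x. f x v)" for x v
    using assms by (auto simp: k_bilinear_def)
  have "(\<Sum>(x, v)\<leftarrow>\<rho> r. f x v) = (\<Sum>(x, v)\<leftarrow>\<rho> r. \<Sum>j<N. sZ (\<phi> j v) (f x (d j)))"
    by (subst lin_expand[OF *(1)]) simp
  also have "\<dots> = (\<Sum>j<N. \<Sum>(x, v)\<leftarrow>\<rho> r. sZ (\<phi> j v) (f x (d j)))"
    by (rule sum_list_swap)
  also have "\<dots> = (\<Sum>j<N. f (coact_coeff r j) (d j))"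
    unfolding coact_coeff_def using *(2)
    by (subst scale_sum_list[OF *(2)]) (simp add: lin_iff)
  finally show ?thesis .
qed

lemma sum_coact2:
  "(\<Sum>(x, v, w)\<leftarrow>coact2 r s. f x v w) = (\<Sum>(x, v)\<leftarrow>\<rho> r. \<Sum>(y, w)\<leftarrow>\<rho> s. f (x * y) v w)"
  unfolding coact2_def by (simp add: sum_list_concat_map case_prod_unfold comp_def)

lemma sum_comult2:
  "(\<Sum>((a, b), (c, e))\<leftarrow>comult2 r s. F a b c e)
   = (\<Sum>(r1, r2)\<leftarrow>\<delta> r. \<Sum>(x, r20)\<leftarrow>\<rho> r2. \<Sum>(s1, s2)\<leftarrow>\<delta> s. F r1 (x \<rhd> s1) r20 s2)"
  unfolding comult2_def by (simp add: sum_list_concat_map case_prod_unfold comp_def)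

lemma counit_d: "n < N \<Longrightarrow> \<epsilon> (d n) = (if n = 0 then 1 else 0)"
proof -
  assume n: "n < N"
  have "d n = (\<Sum>(a, b)\<leftarrow>\<delta> (d n). sR (\<epsilon> a) b)" by (simp add: R.counit_left)
  also have "\<dots> = (\<Sum>t\<le>n. sR (\<epsilon> (d t)) (d (n - t)))"
    by (rule sum_comult_d[OF n, where sZ=sR]) (intro lin_intros)
  finally have "\<phi> 0 (d n) = \<phi> 0 (\<Sum>t\<le>n. sR (\<epsilon> (d t)) (d (n - t)))" by simp
  also have "\<dots> = (\<Sum>t\<le>n. \<epsilon> (d t) * \<phi> 0 (d (n - t)))"
  proof -
    interpret Vector_Spaces.linear sR "(*)" "\<phi> 0" by (rule lin_coord)
    show ?thesis by (simp add: sum scale)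
  qed
  also have "\<dots> = (\<Sum>t\<le>n. if t = n then \<epsilon> (d t) else 0)"
    by (intro sum.cong) (use n in \<open>auto simp: coord_d\<close>)
  finally show ?thesis using n by (simp add: coord_d)
qed

lemma coord_0: "\<phi> 0 v = \<epsilon> v"
  by (rule lin_eqI[OF lin_coord R.counit_linear]) (simp add: coord_d counit_d)

lemma coord_comult:
  assumes "lin (*) sZ (\<lambda>c. sZ c z)"
  shows "(\<Sum>(a, b)\<leftarrow>\<delta> r. sZ (\<phi> i a * \<phi> j b) z) = sZ (\<phi> (i + j) r) z"
proof (rule lin_eqI[where sZ=sZ])
  have vZ: "vector_space sZ" using assms by (simp add: lin_iff)
  then interpret vector_space sZ .
  show "lin sR sZ (\<lambda>r. \<Sum>(a, b)\<leftarrow>\<delta> r. sZ (\<phi> i a * \<phi> j b) z)"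
    by (intro lin_intros lin_compose[OF assms])
  show "lin sR sZ (\<lambda>r. sZ (\<phi> (i + j) r) z)"
    by (intro lin_compose[OF assms] lin_coord)
  fix n assume n: "n < N"
  have "(\<Sum>(a, b)\<leftarrow>\<delta> (d n). sZ (\<phi> i a * \<phi> j b) z) = (\<Sum>t\<le>n. sZ (\<phi> i (d t) * \<phi> j (d (n - t))) z)"
    by (rule sum_comult_d[OF n, where sZ=sZ]) (intro lin_intros lin_compose[OF assms])
  also have "\<dots> = (\<Sum>t\<le>n. if t = i then sZ (\<phi> j (d (n - i))) z else 0)"
    by (intro sum.cong) (use n in \<open>auto simp: coord_d\<close>)
  also have "\<dots> = sZ (\<phi> (i + j) (d n)) z"
    using n by (auto simp: coord_d)
  finally show "(\<Sum>(a, b)\<leftarrow>\<delta> (d n). sZ (\<phi> i a * \<phi> j b) z) = sZ (\<phi> (i + j) (d n)) z" .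
qed

text \<open>Dually: \<open>R\<^sup>*\<close> is the algebra generated by \<open>\<phi> 1\<close> with \<open>\<phi> i\<close> its powers, and it is an
  \<open>H\<close>-comodule algebra.  So the matrix of the coaction is determined by its column \<open>1\<close>.\<close>

lemma coact_coeff_add:
  assumes n: "n < N"
  shows "coact_coeff (d n) (i + j) = (\<Sum>t\<le>n. coact_coeff (d t) i * coact_coeff (d (n - t)) j)"
proof -
  have lc: "lin (*) sH (\<lambda>c. sH c x)" for x by (intro lin_intros)
  have "coact_coeff (d n) (i + j) = (\<Sum>(x, r0)\<leftarrow>\<rho> (d n). \<Sum>(a, b)\<leftarrow>\<delta> r0. sH (\<phi> i a * \<phi> j b) x)"
    unfolding coact_coeff_def coord_comult[OF lc] ..
  also have "\<dots> = (\<Sum>(x, a, b)\<leftarrow>[(x, r1, r2). (x, r0) \<leftarrow> \<rho> (d n), (r1, r2) \<leftarrow> \<delta> r0]. sH (\<phi> i a * \<phi> j b) x)"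
    by (simp add: sum_list_concat_map case_prod_unfold comp_def)
  also have "\<dots> = (\<Sum>(x, a, b)\<leftarrow>[(x, r10, r20). (r1, r2) \<leftarrow> \<delta> (d n), (x, r10, r20) \<leftarrow> coact2 r1 r2]. sH (\<phi> i a * \<phi> j b) x)"
    by (rule teq3_sum[OF comult_coact, where sZ=sH]) (intro lin_intros)+
  also have "\<dots> = (\<Sum>(r1, r2)\<leftarrow>\<delta> (d n). \<Sum>(x, a, b)\<leftarrow>coact2 r1 r2. sH (\<phi> i a * \<phi> j b) x)"
    by (simp add: sum_list_concat_map case_prod_unfold comp_def)
  also have "\<dots> = (\<Sum>(r1, r2)\<leftarrow>\<delta> (d n). coact_coeff r1 i * coact_coeff r2 j)"
    unfolding sum_coact2 coact_coeff_def sum_list_mult by (simp add: mult.commute)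
  also have "\<dots> = (\<Sum>t\<le>n. coact_coeff (d t) i * coact_coeff (d (n - t)) j)"
    by (rule sum_comult_d[OF n, where sZ=sH]) (intro lin_intros lin_compose[OF lin_coact_coeff])
  finally show ?thesis .
qed

lemma coact_coeff_right_0: "n < N \<Longrightarrow> coact_coeff (d n) 0 = (if n = 0 then 1 else 0)"
  by (simp add: coact_coeff_def coord_0 counit_coact counit_d)

lemma coact_coeff_left_0: "coact_coeff (d 0) j = (if j = 0 then 1 else 0)"
proof -
  have "coact_coeff (d 0) j = (\<Sum>(x, v)\<leftarrow>[(1, u 1)]. sH (\<phi> j v) x)"
    unfolding coact_coeff_def d_0 by (rule teq_sum[OF coact_unit, where sZ=sH]) (intro lin_intros)
  then show ?thesis using N_ge by (simp add: d_0[symmetric] coord_d)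
qed

lemma coact_coeff_left_1: "coact_coeff (d 1) j = (if j = 1 then g else 0)"
proof -
  have "coact_coeff (d 1) j = (\<Sum>(x, v)\<leftarrow>[(g, d 1)]. sH (\<phi> j v) x)"
    unfolding coact_coeff_def by (rule teq_sum[OF coact_y, where sZ=sH]) (intro lin_intros)
  then show ?thesis using N_ge by (simp add: coord_d)
qed

text \<open>Column \<open>j\<close> is the \<open>j\<close>-fold convolution power of column \<open>1\<close>, which starts
  with \<open>0\<close> in row \<open>0\<close> and \<open>g\<close> in row \<open>1\<close>.\<close>

lemma coact_coeff_triangular:
  "n < N \<Longrightarrow> n \<le> j \<Longrightarrow> coact_coeff (d n) j = (if n = j then g ^ n else 0)"
proof (induction j arbitrary: n)
  case 0
  then show ?case by (simp add: coact_coeff_right_0)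
next
  case (Suc j)
  have "coact_coeff (d n) (1 + j) = (\<Sum>t\<le>n. coact_coeff (d t) 1 * coact_coeff (d (n - t)) j)"
    by (rule coact_coeff_add[OF Suc.prems(1)])
  also have "\<dots> = (\<Sum>t\<le>n. if t = 1 then (if n = Suc j then g ^ n else 0) else 0)"
  proof (intro sum.cong refl)
    fix t assume t: "t \<in> {..n}"
    show "coact_coeff (d t) 1 * coact_coeff (d (n - t)) j
        = (if t = 1 then (if n = Suc j then g ^ n else 0) else 0)"
    proof (cases "t = 0")
      case True
      then show ?thesis by (simp add: coact_coeff_left_0)
    next
      case False
      then have "coact_coeff (d (n - t)) j = (if n - t = j then g ^ j else 0)"
        using Suc.IH[of "n - t"] Suc.prems t by auto
      then show ?thesis using False Suc.prems t
        by (cases "t = 1") (auto simp: coact_coeff_left_1[unfolded One_nat_def])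
    qed
  qed
  finally show ?case by auto
qed

lemma coord_scale: "\<phi> j (sR c v) = c * \<phi> j v"
  and coord_zero [simp]: "\<phi> j 0 = 0"
proof -
  interpret Vector_Spaces.linear sR "(*)" "\<phi> j" by (rule lin_coord)
  show "\<phi> j (sR c v) = c * \<phi> j v" "\<phi> j 0 = 0"
    by (simp_all add: scale zero)
qed

lemma coord_act_g: "\<phi> j (g \<rhd> v) = q ^ j * \<phi> j v"
  by (rule lin_eqI[where sZ="(*)"])
    (auto intro!: lin_intros simp: act_d conv_power_g coord_scale coord_d)

lemma q_power_theta: "q ^ \<theta> = 1" and q_nz: "q \<noteq> 0"
  and q_power_ne_1: "0 < k \<Longrightarrow> k < \<theta> \<Longrightarrow> q ^ k \<noteq> 1"
proof -
  show 1: "q ^ \<theta> = 1" and "0 < k \<Longrightarrow> k < \<theta> \<Longrightarrow> q ^ k \<noteq> 1"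
    using root by (auto simp: primitive_unity_root_def)
  show "q \<noteq> 0" using 1 theta_ge by (auto simp: power_0_left)
qed

text \<open>The Yetter--Drinfeld condition for \<open>h = g\<close>: conjugation by \<open>g\<close> scales the coefficients
  by the difference of the weights of \<open>d n\<close> and \<open>d j\<close>.\<close>

lemma weight_coact_coeff:
  assumes n: "n < N" "j \<le> n"
  shows "g * coact_coeff (d n) j = sH (q ^ (n - j)) (coact_coeff (d n) j * g)"
proof -
  let ?c = "coact_coeff (d n) j"
  let ?f = "\<lambda>h1 h2 h3. \<Sum>(x, v)\<leftarrow>\<rho> (d n). sH (\<phi> j (h2 \<rhd> v)) (h1 * x * S h3)"
  have "sH (q ^ n) ?c = coact_coeff (g \<rhd> d n) j"
    using lin_coact_coeff[of j] by (simp add: act_d[OF n(1)] conv_power_g lin_iff)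
  also have "\<dots> = (\<Sum>(x, v)\<leftarrow>[(h1 * x * S h3, h2 \<rhd> v0). (h1, h') \<leftarrow> \<Delta> g, (h2, h3) \<leftarrow> \<Delta> h', (x, v0) \<leftarrow> \<rho> (d n)].
      sH (\<phi> j v) x)"
    unfolding coact_coeff_def by (rule teq_sum[OF yd_compat, where sZ=sH]) (intro lin_intros)
  also have "\<dots> = (\<Sum>(h1, h')\<leftarrow>\<Delta> g. \<Sum>(h2, h3)\<leftarrow>\<Delta> h'. ?f h1 h2 h3)"
    by (simp add: sum_list_concat_map case_prod_unfold comp_def)
  also have "\<dots> = (\<Sum>(h2, h3)\<leftarrow>\<Delta> g. ?f g h2 h3)"
    by (rule sum_comult_g[where sZ=sH]) (intro lin_intros)
  also have "\<dots> = ?f g g g"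
    by (rule sum_comult_g[where sZ=sH]) (intro lin_intros)
  also have "\<dots> = (\<Sum>(x, v)\<leftarrow>\<rho> (d n). sH (q ^ j) (g * sH (\<phi> j v) x * S g))"
    by (simp add: coord_act_g)
  also have "\<dots> = sH (q ^ j) (g * ?c * S g)"
    unfolding coact_coeff_def
    by (rule scale_sum_list[where sA=sH and sB=sH, symmetric]) (intro lin_intros)
  finally have "sH (q ^ n) (?c * g) = sH (q ^ j) (g * ?c * S g) * g"
    by (metis scale_mult_H(1))
  then have "sH (inverse (q ^ j)) (sH (q ^ n) (?c * g)) = sH (inverse (q ^ j)) (sH (q ^ j) (g * ?c))"
    by (simp add: mult.assoc antipode_g)
  moreover have "inverse (q ^ j) * q ^ n = q ^ (n - j)"
    using n q_nz by (simp add: power_diff field_simps)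
  ultimately show ?thesis using q_nz by simp
qed

text \<open>A character cannot see noncommutativity, and \<open>\<chi>\<^sup>n(g) \<noteq> 0\<close>.\<close>

lemma conv_power_weight:
  assumes "g * w = sH c (w * g)" "c \<noteq> 1"
  shows "H.conv_power \<chi> n w = 0"
proof -
  have "H.conv_power \<chi> n (g * w) = c * H.conv_power \<chi> n (w * g)"
    using lin_conv_power[of n] by (simp add: assms(1) lin_iff)
  then have "q ^ n * ((1 - c) * H.conv_power \<chi> n w) = 0"
    by (simp add: conv_power_mult conv_power_g algebra_simps)
  then show ?thesis using assms(2) q_nz by simp
qed

lemma conv_power_power: "H.conv_power \<chi> n (h ^ k) = H.conv_power \<chi> n h ^ k"
  by (induction k) (simp_all add: conv_power_one conv_power_mult)

text \<open>The bound \<open>n \<le> \<theta>\<close> keeps the weight \<open>n - j\<close> of an entry below the diagonal strictly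
  between \<open>0\<close> and \<open>\<theta>\<close>, since column \<open>0\<close> is known separately.\<close>

lemma conv_power_coact_coeff:
  assumes "n < N" "n \<le> \<theta>"
  shows "H.conv_power \<chi> t (coact_coeff (d n) j) = (if n = j then q ^ (n * t) else 0)"
proof -
  have z: "H.conv_power \<chi> t 0 = 0" using conv_power_weight[of 0 0] by simp
  consider "n \<le> j" | "j = 0" "j < n" | "0 < j" "j < n" by linarith
  then show ?thesis
  proof cases
    case 1
    then show ?thesis using assms
      by (auto simp: coact_coeff_triangular z conv_power_power conv_power_g power_mult[symmetric] mult.commute)
  next
    case 2
    then show ?thesis using assms by (auto simp: coact_coeff_right_0 z)
  next
    case 3
    then show ?thesis
      using conv_power_weight[OF weight_coact_coeff[of n j] q_power_ne_1[of "n - j"]] assms by auto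
  qed
qed

text \<open>The braiding only uses the coaction through the action of its coefficients on the
  basis vectors \<open>d t\<close>, that is, through \<open>\<chi>\<^sup>t\<close>.  The off-diagonal coefficients drop out and each
  crossing contributes a power of \<open>q\<close>.\<close>

lemma sum_comult2_d:
  assumes i: "i < N" "i \<le> \<theta>" and j: "j < N"
    and F: "\<And>b c e. lin sR sZ (\<lambda>a. F a b c e)" "\<And>a c e. lin sR sZ (\<lambda>b. F a b c e)"
      "\<And>a b e. lin sR sZ (\<lambda>c. F a b c e)" "\<And>a b c. lin sR sZ (\<lambda>e. F a b c e)"
  shows "(\<Sum>((a, b), (c, e))\<leftarrow>comult2 (d i) (d j). F a b c e)
   = (\<Sum>s\<le>i. \<Sum>t\<le>j. sZ (q ^ ((i - s) * t)) (F (d s) (d t) (d (i - s)) (d (j - t))))"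
proof -
  have vZ: "vector_space sZ" using F(1) by (simp add: lin_iff)
  then interpret Z: vector_space sZ .
  note FI = lin_compose[OF F(1)] lin_compose[OF F(2)] lin_compose[OF F(3)] lin_compose[OF F(4)]
  let ?G = "\<lambda>r1 r2. \<Sum>(x, r20)\<leftarrow>\<rho> r2. \<Sum>(s1, s2)\<leftarrow>\<delta> (d j). F r1 (x \<rhd> s1) r20 s2"
  have G: "?G (d s) (d k) = (\<Sum>t\<le>j. sZ (q ^ (k * t)) (F (d s) (d t) (d k) (d (j - t))))"
    if k: "k < N" "k \<le> \<theta>" for s k
  proof -
    have "?G (d s) (d k) = (\<Sum>l<N. \<Sum>(s1, s2)\<leftarrow>\<delta> (d j). F (d s) (coact_coeff (d k) l \<rhd> s1) (d l) s2)"
      by (rule sum_coact[where sZ=sZ]) (intro lin_intros vZ FI)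
    also have "\<dots> = (\<Sum>l<N. \<Sum>t\<le>j. F (d s) (coact_coeff (d k) l \<rhd> d t) (d l) (d (j - t)))"
      by (intro sum.cong refl sum_comult_d[OF j, where sZ=sZ]) (intro lin_intros vZ FI)
    also have "\<dots> = (\<Sum>l<N. if l = k then \<Sum>t\<le>j. sZ (q ^ (k * t)) (F (d s) (d t) (d k) (d (j - t))) else 0)"
    proof (intro sum.cong refl)
      fix l assume "l \<in> {..<N}"
      have "F (d s) (coact_coeff (d k) l \<rhd> d t) (d l) (d (j - t))
          = sZ (if l = k then q ^ (k * t) else 0) (F (d s) (d t) (d l) (d (j - t)))" if "t \<in> {..j}" for t
        using that j F(2) by (simp add: act_d conv_power_coact_coeff[OF k] lin_iff)
      then show "(\<Sum>t\<le>j. F (d s) (coact_coeff (d k) l \<rhd> d t) (d l) (d (j - t)))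
          = (if l = k then \<Sum>t\<le>j. sZ (q ^ (k * t)) (F (d s) (d t) (d k) (d (j - t))) else 0)"
        by simp
    qed
    also have "\<dots> = (\<Sum>t\<le>j. sZ (q ^ (k * t)) (F (d s) (d t) (d k) (d (j - t))))"
      using k by simp
    finally show ?thesis .
  qed
  have "(\<Sum>((a, b), (c, e))\<leftarrow>comult2 (d i) (d j). F a b c e) = (\<Sum>(r1, r2)\<leftarrow>\<delta> (d i). ?G r1 r2)"
    by (rule sum_comult2)
  also have "\<dots> = (\<Sum>s\<le>i. ?G (d s) (d (i - s)))"
    by (rule sum_comult_d[OF i(1), where sZ=sZ]) (intro lin_intros vZ FI)
  also have "\<dots> = (\<Sum>s\<le>i. \<Sum>t\<le>j. sZ (q ^ ((i - s) * t)) (F (d s) (d t) (d (i - s)) (d (j - t))))"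
    by (intro sum.cong refl G) (use i in auto)
  finally show ?thesis .
qed

section \<open>The order of q\<close>

lemma q_power_eq_1_iff: "q ^ k = 1 \<longleftrightarrow> \<theta> dvd k"
proof -
  have "q ^ k = q ^ (\<theta> * (k div \<theta>) + k mod \<theta>)" by simp
  also have "\<dots> = q ^ (k mod \<theta>)" by (simp only: power_add power_mult q_power_theta) simp
  finally have *: "q ^ k = q ^ (k mod \<theta>)" .
  show ?thesis
  proof (cases "k mod \<theta> = 0")
    case True
    then show ?thesis using * by auto
  next
    case False
    then have "q ^ (k mod \<theta>) \<noteq> 1" using q_power_ne_1[of "k mod \<theta>"] theta_ge by simp
    then show ?thesis using * False by (auto simp: dvd_eq_mod_eq_0)
  qed
qed

lemma qint_eq_0_iff: "qint q k = 0 \<longleftrightarrow> \<theta> dvd k"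
proof -
  have "q \<noteq> 1" using q_power_ne_1[of 1] theta_ge by simp
  then show ?thesis using qint_geometric[of q k] q_power_eq_1_iff[of k] by auto
qed

lemma qfact_nz: "k < \<theta> \<Longrightarrow> qfact q k \<noteq> 0"
proof (induction k)
  case (Suc k)
  then show ?case using nat_dvd_not_less[of "Suc k" \<theta>] by (simp add: qfact_Suc qint_eq_0_iff)
qed simp

lemma weight_xi:
  assumes "i < N" "j < N"
  shows "g * \<xi> (d i) (d j) = sH (q ^ (i + j)) (\<xi> (d i) (d j) * g)"
proof -
  let ?x = "\<xi> (d i) (d j)"
  have "sH (q ^ (i + j)) ?x = \<xi> (g \<rhd> d i) (g \<rhd> d j)"
    using xi_bilinear assms by (simp add: act_d conv_power_g k_bilinear_def lin_iff power_add)
  also have "\<dots> = (\<Sum>(h1, h2)\<leftarrow>\<Delta> g. \<xi> (h1 \<rhd> d i) (h2 \<rhd> d j))"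
    by (rule sum_comult_g[where sZ=sH, symmetric]) (intro lin_intros)
  also have "\<dots> = (\<Sum>(h1, h2)\<leftarrow>\<Delta> g. h1 * ?x * S h2)" by (rule xi_act)
  also have "\<dots> = g * ?x * S g"
    by (rule sum_comult_g[where sZ=sH]) (intro lin_intros)
  finally have "sH (q ^ (i + j)) ?x * g = g * ?x * S g * g" by simp
  then show ?thesis by (simp add: mult.assoc antipode_g)
qed

lemma conv_power_xi_weight:
  assumes "i < N" "j < N" "\<not> \<theta> dvd i + j"
  shows "H.conv_power \<chi> n (\<xi> (d i) (d j)) = 0"
  using conv_power_weight[OF weight_xi[OF assms(1,2)]] assms(3) by (simp add: q_power_eq_1_iff)

lemma xi_0_left: "j < N \<Longrightarrow> \<xi> (d 0) (d j) = (if j = 0 then 1 else 0)"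
  using xi_unit_left[of "d j"] by (simp add: d_0 counit_d)

lemma conv_power_xi_00: "H.conv_power \<chi> n (\<xi> (d 0) (d 0)) = 1"
  using N_ge by (simp add: xi_0_left conv_power_one)

lemma m_0 [simp]: "m (d 0) v = v" "m v (d 0) = v"
  by (simp_all add: d_0 m_unit_left m_unit_right)

lemma m_scale [simp]: "m (sR c v) w = sR c (m v w)" "m v (sR c w) = sR c (m v w)" "m 0 w = 0" "m v 0 = 0"
proof -
  show "m (sR c v) w = sR c (m v w)" "m v (sR c w) = sR c (m v w)" for c v w
    using m_bilinear by (auto simp: k_bilinear_def lin_iff)
  from this(1)[of 0] this(2)[of _ 0] show "m 0 w = 0" "m v 0 = 0" by simp_all
qed

lemma coord_mult:
  assumes a: "a < N" "a \<le> \<theta>" and b: "b < N"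
  shows "\<phi> (i + j) (m (d a) (d b)) = (\<Sum>s\<le>a. \<Sum>t\<le>b. q ^ ((a - s) * t) *
      (\<phi> i (m (d s) (d t)) * \<phi> j (m (d (a - s)) (d (b - t)))))"
proof -
  have l: "lin (*) (*) (\<lambda>c. c * (1::'k))" by (intro lin_intros)
  have "\<phi> (i + j) (m (d a) (d b)) = (\<Sum>(v, w)\<leftarrow>\<delta> (m (d a) (d b)). \<phi> i v * \<phi> j w)"
    using coord_comult[OF l, of i j] by simp
  also have "\<dots> = (\<Sum>(v, w)\<leftarrow>[(m a' b', m c e). ((a', b'), (c, e)) \<leftarrow> comult2 (d a) (d b)]. \<phi> i v * \<phi> j w)"
    by (rule teq_sum[OF comult_m, where sZ="(*)"]) (intro lin_intros)
  also have "\<dots> = (\<Sum>((a', b'), (c, e))\<leftarrow>comult2 (d a) (d b). \<phi> i (m a' b') * \<phi> j (m c e))"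
    by (simp add: case_prod_unfold comp_def)
  also have "\<dots> = (\<Sum>s\<le>a. \<Sum>t\<le>b. q ^ ((a - s) * t) *
      (\<phi> i (m (d s) (d t)) * \<phi> j (m (d (a - s)) (d (b - t)))))"
    by (rule sum_comult2_d[OF a b, where sZ="(*)"]) (intro lin_intros)+
  finally show ?thesis .
qed

lemma coord_y_d:
  assumes "Suc n < N"
  shows "\<phi> j (m (d (Suc 0)) (d n)) = (if j = Suc n then qint q (Suc n) else 0)"
  using y_d[OF assms] assms by (auto simp: coord_scale coord_d)

lemma coord_mult_y:
  assumes b: "b < N"
  shows "\<phi> (i + j) (m (d (Suc 0)) (d b)) =
     (\<Sum>t\<le>b. q ^ t * (\<phi> i (d t) * \<phi> j (m (d (Suc 0)) (d (b - t)))))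
     + (\<Sum>t\<le>b. \<phi> i (m (d (Suc 0)) (d t)) * \<phi> j (d (b - t)))"
  using coord_mult[of "Suc 0" b i j] N_ge theta_ge b by simp

text \<open>Two facts about the product of \<open>y\<close> with the top basis vector.  Its coproduct has the
  coefficient \<open>(N)\<^sub>q\<close> at \<open>d\<^sub>1 \<otimes> d\<^sub>N\<^sub>-\<^sub>1\<close>, but no element of \<open>R\<close> has a nonzero coefficient in total
  degree \<open>N\<close>.  So the product is primitive, hence a multiple of \<open>y\<close>; being of weight
  \<open>q\<^sup>N = 1 \<noteq> q\<close> it vanishes.\<close>

lemma
  shows qint_N: "qint q N = 0" and y_d_top: "m (d 1) (d (N - 1)) = 0"
proof -
  \<comment> \<open>The coefficient of \<open>d 1 \<otimes> d n\<close> in the coproduct.\<close>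
  have split: "\<phi> (Suc n) (m (d (Suc 0)) (d (N - 1))) =
     q * \<phi> n (m (d (Suc 0)) (d (N - 2))) + (if n = N - 1 then 1 else 0)" if n: "0 < n" for n
  proof -
    have "\<phi> (Suc n) (m (d (Suc 0)) (d (N - 1))) = \<phi> (1 + n) (m (d (Suc 0)) (d (N - 1)))" by simp
    also have "\<dots> = (\<Sum>t\<le>N - 1. q ^ t * (\<phi> 1 (d t) * \<phi> n (m (d (Suc 0)) (d (N - 1 - t)))))
     + (\<Sum>t\<le>N - 1. \<phi> 1 (m (d (Suc 0)) (d t)) * \<phi> n (d (N - 1 - t)))"
      by (rule coord_mult_y) (use N_ge in simp)
    also have "(\<Sum>t\<le>N - 1. q ^ t * (\<phi> 1 (d t) * \<phi> n (m (d (Suc 0)) (d (N - 1 - t)))))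
        = (\<Sum>t\<le>N - 1. if t = 1 then q * \<phi> n (m (d (Suc 0)) (d (N - 1 - t))) else 0)"
      by (intro sum.cong) (use N_ge in \<open>auto simp: coord_d\<close>)
    also have "\<dots> = q * \<phi> n (m (d (Suc 0)) (d (N - 2)))"
    proof -
      have "Suc 0 \<le> N - Suc 0" using N_ge by linarith
      then show ?thesis by (simp add: numeral_2_eq_2)
    qed
    also have "(\<Sum>t\<le>N - 1. \<phi> 1 (m (d (Suc 0)) (d t)) * \<phi> n (d (N - 1 - t)))
        = (\<Sum>t\<le>N - 1. if t = 0 then if n = N - 1 then 1 else 0 else 0)"
    proof (intro sum.cong refl)
      fix t assume t: "t \<in> {..N - 1}"
      consider "t = 0" | "0 < t" "t < N - 1" | "0 < t" "t = N - 1" using t by fastforce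
      then show "\<phi> 1 (m (d (Suc 0)) (d t)) * \<phi> n (d (N - 1 - t))
          = (if t = 0 then if n = N - 1 then 1 else 0 else 0)"
        using n N_ge by cases (auto simp: coord_d coord_y_d)
    qed
    also have "\<dots> = (if n = N - 1 then 1 else 0)" by simp
    finally show ?thesis .
  qed
  have y2: "\<phi> n (m (d (Suc 0)) (d (N - 2))) = (if n = N - 1 then qint q (N - 1) else 0)" for n
    using coord_y_d[of "N - 2" n] N_ge by (simp add: Suc_diff_Suc numeral_2_eq_2)
  have "0 = q * qint q (N - 1) + 1"
    using split[of "N - 1"] N_ge by (simp add: y2 coord_def[of N])
  also have "\<dots> = qint q N"
    using qint_Suc[of q "N - 1"] N_ge by simp
  finally show qN: "qint q N = 0" by simp
  let ?z = "m (d (Suc 0)) (d (N - 1))"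
  have "g \<rhd> ?z = (\<Sum>(h1, h2)\<leftarrow>\<Delta> g. m (h1 \<rhd> d (Suc 0)) (h2 \<rhd> d (N - 1)))" by (rule act_m)
  also have "\<dots> = m (g \<rhd> d (Suc 0)) (g \<rhd> d (N - 1))"
    by (rule sum_comult_g[where sZ=sR]) (intro lin_intros)
  also have "\<dots> = sR (q ^ N) ?z"
    using N_ge by (simp add: act_d conv_power_g power_Suc2[symmetric] del: H.conv_power.simps)
  also have "q ^ N = 1" using qN by (simp add: qint_eq_0_iff q_power_eq_1_iff)
  finally have "q * \<phi> 1 ?z = \<phi> 1 ?z" using coord_act_g[of 1 ?z] by simp
  moreover have "q \<noteq> 1" using q_power_ne_1[of 1] theta_ge by simp
  ultimately have z1: "\<phi> (Suc 0) ?z = 0" by simp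
  have z0: "\<phi> 0 ?z = 0" using N_ge by (simp add: coord_0 counit_m counit_d)
  have "\<phi> j ?z = \<phi> j 0" if j: "j < N" for j
  proof -
    consider "j = 0" | "j = Suc 0" | n where "j = Suc n" "0 < n" by (cases j; cases "j - 1") auto
    then show ?thesis
    proof cases
      case 3
      then show ?thesis using j split[of n] y2[of n] by simp
    qed (use z0 z1 in simp_all)
  qed
  then show "m (d 1) (d (N - 1)) = 0" by (intro eq_if_coord_eq) simp
qed

text \<open>The failure of associativity is measured by the values of \<open>\<chi>\<^sup>k\<close> on \<open>\<xi>\<close>.\<close>

lemma m_assoc_d:
  assumes i: "i < N" "i \<le> \<theta>" and j: "j < N" and k: "k < N"
  shows "m (d i) (m (d j) (d k)) = (\<Sum>s\<le>i. \<Sum>t\<le>j. sR (q ^ ((i - s) * t) *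
     H.conv_power \<chi> k (\<xi> (d (i - s)) (d (j - t)))) (m (m (d s) (d t)) (d k)))"
proof -
  have "m (d i) (m (d j) (d k)) = (\<Sum>s\<le>i. \<Sum>t\<le>j. sR (q ^ ((i - s) * t))
     (m (m (d s) (d t)) (\<xi> (d (i - s)) (d (j - t)) \<rhd> d k)))"
    unfolding m_assoc_xi[of "d i"]
    by (rule sum_comult2_d[OF i j, where sZ=sR]) (intro lin_intros)+
  then show ?thesis by (simp add: act_d[OF k])
qed

text \<open>Below degree \<open>\<theta>\<close> the correction terms of \<open>m_assoc_d\<close> have nonzero weight and vanish, so
  multiplication by \<open>y\<close> from the left associates.\<close>

lemma y_m_d:
  assumes "Suc n < \<theta>"
  shows "m (d (Suc 0)) (m (d n) v) = sR (qint q (Suc n)) (m (d (Suc n)) v)"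
proof (rule lin_eqI[where sZ=sR and f="\<lambda>v. m (d (Suc 0)) (m (d n) v)"])
  show "lin sR sR (\<lambda>v. m (d (Suc 0)) (m (d n) v))"
    "lin sR sR (\<lambda>v. sR (qint q (Suc n)) (m (d (Suc n)) v))"
    by (intro lin_intros)+
  fix k assume k: "k < N"
  have n: "n < N" "Suc n < N" using assms theta_le by auto
  have "m (d (Suc 0)) (m (d n) (d k)) = (\<Sum>s\<le>Suc 0. \<Sum>t\<le>n. sR (q ^ ((Suc 0 - s) * t) *
     H.conv_power \<chi> k (\<xi> (d (Suc 0 - s)) (d (n - t)))) (m (m (d s) (d t)) (d k)))"
    by (rule m_assoc_d) (use n k N_ge theta_ge in auto)
  also have "\<dots> = m (m (d (Suc 0)) (d n)) (d k)"
  proof (subst double_sum_single[where x="Suc 0" and y=n], goal_cases)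
    case (3 s t)
    have "\<not> \<theta> dvd (Suc 0 - s) + (n - t)"
      by (rule nat_dvd_not_less) (use 3 assms in auto)
    then show ?case using n N_ge 3 by (simp add: conv_power_xi_weight)
  qed (simp_all add: conv_power_xi_00)
  also have "\<dots> = sR (qint q (Suc n)) (m (d (Suc n)) (d k))"
    using y_d[OF n(2)] by simp
  finally show "m (d (Suc 0)) (m (d n) (d k)) = sR (qint q (Suc n)) (m (d (Suc n)) (d k))" .
qed

lemma m_d_iterate: "n < \<theta> \<Longrightarrow> sR (qfact q n) (m (d n) v) = (m (d (Suc 0)) ^^ n) v"
proof (induction n)
  case (Suc n)
  then have "(m (d (Suc 0)) ^^ Suc n) v = m (d (Suc 0)) (sR (qfact q n) (m (d n) v))" by simp
  also have "\<dots> = sR (qfact q (Suc n)) (m (d (Suc n)) v)"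
    using y_m_d[OF Suc.prems, of v] by (simp add: qfact_Suc)
  finally show ?case by simp
qed simp

text \<open>Suppose \<open>\<theta> < N\<close> and let \<open>l b\<close> be the coefficient of \<open>d (\<theta> + b)\<close> in \<open>d \<theta> * d b\<close>.
  As \<open>d s\<close> is a multiple of \<open>y\<^sup>s\<close> for \<open>s < \<theta>\<close> and \<open>(\<theta>)\<^sub>q = 0\<close>, no product \<open>d s * v\<close> with
  \<open>0 < s < \<theta>\<close> has a component at \<open>d \<theta>\<close>.  Comparing coefficients of \<open>d \<theta> \<otimes> d b\<close> in the
  coproduct of \<open>d \<theta> * d b\<close> then gives \<open>l b = 1 + l (b - \<theta>)\<close>, as in a classical divided power
  algebra.  So \<open>l b\<close> is a positive integer for every \<open>b < N\<close>, whereas \<open>l (N - 1) = 0\<close> since there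
  is no basis vector of that degree.\<close>

lemma theta_eq_N: "\<theta> = N"
proof (rule ccontr)
  assume "\<theta> \<noteq> N"
  with theta_le have less: "\<theta> < N" by simp
  have y0: "\<phi> \<theta> (m (d (Suc 0)) w) = 0" for w
  proof (rule lin_eqI[where sZ="(*)" and f="\<lambda>w. \<phi> \<theta> (m (d (Suc 0)) w)"])
    show "lin sR (*) (\<lambda>w. \<phi> \<theta> (m (d (Suc 0)) w))" "lin sR (*) (\<lambda>w. 0 :: 'k)"
      by (intro lin_intros) (simp add: lin_iff vs)
    fix n assume n: "n < N"
    have "qint q \<theta> = 0" by (simp add: qint_eq_0_iff)
    then show "\<phi> \<theta> (m (d (Suc 0)) (d n)) = 0"
    proof (cases "Suc n < N")
      case False
      then have "n = N - Suc 0" using n by simp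
      then show ?thesis using y_d_top by simp
    qed (auto simp: coord_y_d)
  qed
  have ds0: "\<phi> \<theta> (m (d s) v) = 0" if s: "0 < s" "s < \<theta>" for s v
  proof -
    obtain s' where s': "s = Suc s'" using s by (cases s) auto
    have "qfact q s * \<phi> \<theta> (m (d s) v) = \<phi> \<theta> (sR (qfact q s) (m (d s) v))"
      by (simp add: coord_scale)
    also have "\<dots> = 0" by (simp add: m_d_iterate[OF s(2)]) (simp add: s' y0)
    finally show ?thesis using qfact_nz[OF s(2)] by simp
  qed
  define l where "l b = \<phi> (\<theta> + b) (m (d \<theta>) (d b))" for b
  have rec: "l b = 1 + (if \<theta> \<le> b then l (b - \<theta>) else 0)" if b: "b < N" for b
  proof -
    let ?f = "\<lambda>s t. q ^ ((\<theta> - s) * t) * (\<phi> \<theta> (m (d s) (d t)) * \<phi> b (m (d (\<theta> - s)) (d (b - t))))"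
    have "(\<Sum>t\<le>b. ?f s t) = (if s = \<theta> then 1 else 0) + (if s = 0 then if \<theta> \<le> b then l (b - \<theta>) else 0 else 0)"
      if s: "s \<le> \<theta>" for s
    proof -
      consider "s = 0" | "0 < s" "s < \<theta>" | "s = \<theta>" using s by linarith
      then show ?thesis
      proof cases
        case 1
        have "(\<Sum>t\<le>b. ?f s t) = (\<Sum>t\<le>b. if t = \<theta> then q ^ (\<theta> * \<theta>) * \<phi> b (m (d \<theta>) (d (b - \<theta>))) else 0)"
          by (intro sum.cong) (use 1 b in \<open>auto simp: coord_d\<close>)
        then show ?thesis using 1 theta_ge by (auto simp: l_def power_mult q_power_theta)
      next
        case 2
        then show ?thesis by (simp add: ds0)
      next
        case 3
        have "(\<Sum>t\<le>b. ?f s t) = (\<Sum>t\<le>b. if t = 0 then 1 else 0)"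
          by (intro sum.cong) (use 3 b less in \<open>auto simp: coord_d\<close>)
        then show ?thesis using 3 theta_ge by simp
      qed
    qed
    then have "l b = (\<Sum>s\<le>\<theta>. (if s = \<theta> then 1 else 0) + (if s = 0 then if \<theta> \<le> b then l (b - \<theta>) else 0 else 0))"
      unfolding l_def by (subst coord_mult) (use less b in \<open>auto intro!: sum.cong\<close>)
    also have "\<dots> = 1 + (if \<theta> \<le> b then l (b - \<theta>) else 0)"
      by (simp add: sum.distrib)
    finally show ?thesis .
  qed
  have "\<exists>k. l b = of_nat (Suc k)" if "b < N" for b
    using that
  proof (induction b rule: less_induct)
    case (less b)
    show ?case
    proof (cases "\<theta> \<le> b")
      case True
      then have "b - \<theta> < b" "b - \<theta> < N" using less.prems theta_ge by linarith+
      then obtain k where "l (b - \<theta>) = of_nat (Suc k)" using less.IH by blast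
      then have "l b = of_nat (Suc (Suc k))" using rec[OF less.prems] True by simp
      then show ?thesis by blast
    next
      case False
      then have "l b = of_nat (Suc 0)" using rec[OF less.prems] by simp
      then show ?thesis by blast
    qed
  qed
  from this[of "N - 1"] obtain k where "l (N - 1) = of_nat (Suc k)" using N_ge by auto
  moreover have "\<not> \<theta> + (N - 1) < N" using theta_ge by linarith
  then have "l (N - 1) = 0" unfolding l_def coord_def by (simp only: if_False)
  ultimately show False by (metis nat.distinct(1) of_nat_eq_0_iff)
qed

section \<open>Powers of y and values of the cocycle\<close>

definition y_pow :: "nat \<Rightarrow> 'r" where "y_pow = power_R (d (Suc 0))"

lemma y_pow_rec: "y_pow 0 = d 0" "y_pow (Suc n) = m (d (Suc 0)) (y_pow n)"
  by (simp_all add: y_pow_def d_0)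

lemma qfact_eq_0_iff: "qfact q n = 0 \<longleftrightarrow> N \<le> n"
proof
  show "N \<le> n" if "qfact q n = 0" using that qfact_nz[of n] theta_eq_N by force
  assume "N \<le> n"
  then have "N \<in> {1..n}" using N_ge by simp
  then show "qfact q n = 0"
    using qint_N unfolding qfact_def by (meson finite_atLeastAtMost prod_zero)
qed

lemma y_pow_eq: "n < N \<Longrightarrow> y_pow n = sR (qfact q n) (d n)"
proof (induction n)
  case (Suc n)
  then show ?case using y_d[of n] by (simp add: qfact_Suc y_pow_rec)
qed (simp add: y_pow_rec)

lemma y_pow_eq_0: "N \<le> n \<Longrightarrow> y_pow n = 0"
proof (induction n rule: dec_induct)
  case base
  have "y_pow (Suc (N - 1)) = m (d (Suc 0)) (sR (qfact q (N - 1)) (d (N - 1)))"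
    unfolding y_pow_rec(2) using N_ge by (simp add: y_pow_eq)
  then show ?case using y_d_top N_ge by simp
qed (simp add: y_pow_rec)

lemma d_eq_y_pow: "n < N \<Longrightarrow> d n = sR (inverse (qfact q n)) (y_pow n)"
  using qfact_eq_0_iff[of n] by (simp add: y_pow_eq)

lemma iterate_y_pow: "(m (d (Suc 0)) ^^ a) (y_pow b) = y_pow (a + b)"
  by (induction a) (simp_all add: y_pow_rec)

lemma y_pow_add: "m (y_pow a) (y_pow b) = y_pow (a + b)"
proof (cases "a < N")
  case True
  then show ?thesis
    using m_d_iterate[of a "y_pow b"] iterate_y_pow[of a b] by (simp add: theta_eq_N y_pow_eq[OF True])
qed (simp add: y_pow_eq_0)

lemma d_mult:
  assumes "a < N" "b < N"
  shows "m (d a) (d b) = sR (inverse (qfact q a) * inverse (qfact q b)) (y_pow (a + b))"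
  using assms by (simp add: d_eq_y_pow y_pow_add)

lemma d_mult_0: "a < N \<Longrightarrow> b < N \<Longrightarrow> N \<le> a + b \<Longrightarrow> m (d a) (d b) = 0"
  by (simp add: d_mult y_pow_eq_0)

text \<open>Weights leave the degrees \<open>0\<close> and \<open>N\<close>.  In degree \<open>N\<close> the associativity constraint for
  \<open>d i\<close>, \<open>d j\<close>, \<open>d n\<close> decides: both ways of multiplying give \<open>0\<close> because the degree is at
  least \<open>N\<close>, and what remains of the constraint is \<open>\<chi>\<^sup>n(\<xi>(d\<^sub>i \<otimes> d\<^sub>j)) d\<^sub>n = 0\<close>.\<close>

lemma conv_power_xi:
  assumes i: "i < N" and j: "j < N" and n: "n < N"
  shows "H.conv_power \<chi> n (\<xi> (d i) (d j)) = (if i + j = 0 then 1 else 0)"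
proof -
  consider "i + j = 0" | "\<not> N dvd i + j" | "N dvd i + j" "0 < i + j" by blast
  then show ?thesis
  proof cases
    case 1
    then show ?thesis using conv_power_xi_00 by simp
  next
    case 2
    then show ?thesis using conv_power_xi_weight[OF i j] by (cases "i + j = 0") (simp_all add: theta_eq_N)
  next
    case 3
    then obtain k where k: "i + j = N * k" by blast
    have "N * k < N * 2" using i j k by linarith
    then have "k < 2" using N_ge by simp
    moreover have "0 < k" using 3 k by simp
    ultimately have "k = 1" by simp
    with k have ij: "i + j = N" by simp
    show ?thesis
    proof -
    have "0 = m (d i) (m (d j) (d n))"
      by (simp add: d_mult[OF j n]) (simp add: d_eq_y_pow[OF i] y_pow_add y_pow_eq_0 ij add.assoc[symmetric])
    also have "\<dots> = (\<Sum>s\<le>i. \<Sum>t\<le>j. sR (q ^ ((i - s) * t) *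
       H.conv_power \<chi> n (\<xi> (d (i - s)) (d (j - t)))) (m (m (d s) (d t)) (d n)))"
      by (rule m_assoc_d) (use i j n theta_eq_N in auto)
    also have "\<dots> = sR (H.conv_power \<chi> n (\<xi> (d i) (d j))) (d n)"
    proof (subst double_sum_single[where x=0 and y=0], goal_cases)
      case (3 s t)
      show ?case
      proof (cases "s = i \<and> t = j")
        case True
        then show ?thesis using ij i j by (simp add: d_mult_0)
      next
        case False
        then have "\<not> N dvd (i - s) + (j - t)"
          using 3 ij N_ge by (intro nat_dvd_not_less) auto
        then show ?thesis
          using i j by (simp add: conv_power_xi_weight theta_eq_N)
      qed
    qed simp_all
    finally have "\<phi> n (sR (H.conv_power \<chi> n (\<xi> (d i) (d j))) (d n)) = 0"
      by (metis coord_zero)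
    then show ?thesis using n ij N_ge by (simp add: coord_scale coord_d)
    qed
  qed
qed

lemma sum_comult_xi:
  assumes i: "i < N" and j: "j < N" and f: "k_bilinear sH sH sZ f"
  shows "(\<Sum>(h1, h2)\<leftarrow>\<Delta> (\<xi> (d i) (d j)). f h1 h2) =
    (\<Sum>s\<le>i. \<Sum>t\<le>j. sZ (q ^ ((i - s) * t)) (\<Sum>k<N. \<Sum>l<N.
       f (\<xi> (d s) (d t) * (coact_coeff (d (i - s)) k * coact_coeff (d (j - t)) l)) (\<xi> (d k) (d l))))"
proof -
  have "lin sH sZ (f a)" for a using f by (auto simp: k_bilinear_def)
  then have vZ: "vector_space sZ" unfolding lin_iff by blast
  note FI = lin_bilinear_left[OF f] lin_bilinear_right[OF f]
  have "(\<Sum>(h1, h2)\<leftarrow>\<Delta> (\<xi> (d i) (d j)). f h1 h2) =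
      (\<Sum>(h1, h2)\<leftarrow>[(\<xi> a b * x, \<xi> c0 d0). ((a, b), (c, d)) \<leftarrow> comult2 (d i) (d j), (x, c0, d0) \<leftarrow> coact2 c d]. f h1 h2)"
    by (rule teq_sum[OF comult_xi f])
  also have "\<dots> = (\<Sum>((a, b), (c, e))\<leftarrow>comult2 (d i) (d j). \<Sum>(x, c0, d0)\<leftarrow>coact2 c e. f (\<xi> a b * x) (\<xi> c0 d0))"
    by (simp add: sum_list_concat_map case_prod_unfold comp_def)
  also have "\<dots> = (\<Sum>((a, b), (c, e))\<leftarrow>comult2 (d i) (d j). \<Sum>(x, c0)\<leftarrow>\<rho> c. \<Sum>(x', d0)\<leftarrow>\<rho> e.
      f (\<xi> a b * (x * x')) (\<xi> c0 d0))"
    by (simp only: sum_coact2)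
  also have "\<dots> = (\<Sum>s\<le>i. \<Sum>t\<le>j. sZ (q ^ ((i - s) * t)) (\<Sum>(x, c0)\<leftarrow>\<rho> (d (i - s)). \<Sum>(x', d0)\<leftarrow>\<rho> (d (j - t)).
      f (\<xi> (d s) (d t) * (x * x')) (\<xi> c0 d0)))"
    by (rule sum_comult2_d[where sZ=sZ]) (use i j theta_eq_N in \<open>simp_all\<close>, (intro lin_intros FI vZ)+)
  also have "\<dots> = (\<Sum>s\<le>i. \<Sum>t\<le>j. sZ (q ^ ((i - s) * t)) (\<Sum>k<N. \<Sum>l<N.
       f (\<xi> (d s) (d t) * (coact_coeff (d (i - s)) k * coact_coeff (d (j - t)) l)) (\<xi> (d k) (d l))))"
  proof (intro sum.cong refl arg_cong[where f="sZ _"])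
    fix s t
    have "(\<Sum>(x, c0)\<leftarrow>\<rho> (d (i - s)). \<Sum>(x', d0)\<leftarrow>\<rho> (d (j - t)). f (\<xi> (d s) (d t) * (x * x')) (\<xi> c0 d0))
       = (\<Sum>k<N. \<Sum>(x', d0)\<leftarrow>\<rho> (d (j - t)). f (\<xi> (d s) (d t) * (coact_coeff (d (i - s)) k * x')) (\<xi> (d k) d0))"
      by (rule sum_coact[where sZ=sZ]) (intro lin_intros FI vZ)
    also have "\<dots> = (\<Sum>k<N. \<Sum>l<N.
       f (\<xi> (d s) (d t) * (coact_coeff (d (i - s)) k * coact_coeff (d (j - t)) l)) (\<xi> (d k) (d l)))"
      by (intro sum.cong refl sum_coact[where sZ=sZ]) (intro lin_intros FI vZ)
    finally show "(\<Sum>(x, c0)\<leftarrow>\<rho> (d (i - s)). \<Sum>(x', d0)\<leftarrow>\<rho> (d (j - t)). f (\<xi> (d s) (d t) * (x * x')) (\<xi> c0 d0))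
       = (\<Sum>k<N. \<Sum>l<N. f (\<xi> (d s) (d t) * (coact_coeff (d (i - s)) k * coact_coeff (d (j - t)) l)) (\<xi> (d k) (d l)))" .
  qed
  finally show ?thesis .
qed

text \<open>In the formula for \<open>\<Delta>(\<xi>(d\<^sub>i \<otimes> d\<^sub>j))\<close>, the character on the left leg only
  leaves the term whose first factor is \<open>\<xi>(1 \<otimes> 1)\<close>; the coaction then acts by
  its diagonal.\<close>

lemma xi_convolve_left:
  assumes i: "i < N" and j: "j < N" and k: "k < N"
  shows "(\<Sum>(h1, h2)\<leftarrow>\<Delta> (\<xi> (d i) (d j)). sH (H.conv_power \<chi> k h1) h2) = sH (q ^ (k * (i + j))) (\<xi> (d i) (d j))"
proof -
  let ?cp = "H.conv_power \<chi> k"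
  have "(\<Sum>(h1, h2)\<leftarrow>\<Delta> (\<xi> (d i) (d j)). sH (?cp h1) h2) =
    (\<Sum>s\<le>i. \<Sum>t\<le>j. sH (q ^ ((i - s) * t)) (\<Sum>a<N. \<Sum>b<N.
       sH (?cp (\<xi> (d s) (d t) * (coact_coeff (d (i - s)) a * coact_coeff (d (j - t)) b))) (\<xi> (d a) (d b))))"
    by (rule sum_comult_xi[OF i j, where sZ=sH]) (intro lin_intros)
  also have "\<dots> = (\<Sum>a<N. \<Sum>b<N. if a = i \<and> b = j then sH (q ^ (k * (i + j))) (\<xi> (d a) (d b)) else 0)"
  proof (subst double_sum_single[where x=0 and y=0], goal_cases)
    case (3 s t)
    then show ?case using i j k by (auto simp: conv_power_mult conv_power_xi)
  next
    case 4
    have "sH (?cp (\<xi> (d 0) (d 0) * (coact_coeff (d (i - 0)) a * coact_coeff (d (j - 0)) b))) (\<xi> (d a) (d b))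
      = (if a = i \<and> b = j then sH (q ^ (k * (i + j))) (\<xi> (d a) (d b)) else 0)" for a b
      using i j theta_eq_N
      by (simp add: conv_power_mult conv_power_xi_00 conv_power_coact_coeff power_add[symmetric] algebra_simps)
    then show ?case by simp
  qed simp_all
  also have "\<dots> = sH (q ^ (k * (i + j))) (\<xi> (d i) (d j))"
    by (rule sum_indicator[OF i j])
  finally show ?thesis .
qed

lemma conv_power_Suc_0: "H.conv_power \<chi> (Suc 0) h = \<chi> h"
proof -
  have "\<chi> h = \<chi> (\<Sum>(a, b)\<leftarrow>\<Delta> h. sH (\<epsilon>H b) a)" by (simp add: H.counit_right)
  also have "\<dots> = (\<Sum>(a, b)\<leftarrow>\<Delta> h. \<epsilon>H b * \<chi> a)"
    using lin_chi by (subst scale_sum_list[OF lin_chi]) (simp add: lin_iff)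
  finally show ?thesis by (simp add: mult.commute)
qed

text \<open>Here the character on the right leg only leaves the column \<open>0\<close> of the coaction.\<close>

lemma xi_convolve_right:
  assumes i: "i < N" and j: "j < N"
  shows "(\<Sum>(h1, h2)\<leftarrow>\<Delta> (\<xi> (d i) (d j)). sH (\<chi> h2) h1) = \<xi> (d i) (d j)"
proof -
  have chi: "\<chi> (\<xi> (d a) (d b)) = (if a = 0 \<and> b = 0 then 1 else 0)" if "a < N" "b < N" for a b
    using conv_power_xi[OF that, of "Suc 0"] N_ge by (simp add: conv_power_Suc_0 del: H.conv_power.simps)
  have "(\<Sum>(h1, h2)\<leftarrow>\<Delta> (\<xi> (d i) (d j)). sH (\<chi> h2) h1) =
    (\<Sum>s\<le>i. \<Sum>t\<le>j. sH (q ^ ((i - s) * t)) (\<Sum>a<N. \<Sum>b<N.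
       sH (\<chi> (\<xi> (d a) (d b))) (\<xi> (d s) (d t) * (coact_coeff (d (i - s)) a * coact_coeff (d (j - t)) b))))"
    by (rule sum_comult_xi[OF i j, where sZ=sH]) (intro lin_intros)
  also have "\<dots> = (\<Sum>s\<le>i. \<Sum>t\<le>j. sH (q ^ ((i - s) * t))
       (\<xi> (d s) (d t) * (coact_coeff (d (i - s)) 0 * coact_coeff (d (j - t)) 0)))"
  proof (intro sum.cong refl arg_cong[where f="sH _"])
    fix s t
    let ?F = "\<lambda>a b. \<xi> (d s) (d t) * (coact_coeff (d (i - s)) a * coact_coeff (d (j - t)) b)"
    have "(\<Sum>a<N. \<Sum>b<N. sH (\<chi> (\<xi> (d a) (d b))) (?F a b)) = (\<Sum>a<N. \<Sum>b<N. if a = 0 \<and> b = 0 then ?F a b else 0)"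
      by (intro sum.cong) (auto simp: chi)
    also have "\<dots> = ?F 0 0" by (rule sum_indicator) (use N_ge in auto)
    finally show "(\<Sum>a<N. \<Sum>b<N. sH (\<chi> (\<xi> (d a) (d b))) (?F a b)) = ?F 0 0" .
  qed
  also have "\<dots> = \<xi> (d i) (d j)"
  proof (subst double_sum_single[where x=i and y=j], goal_cases)
    case (3 s t)
    then show ?case using i j by (auto simp: coact_coeff_right_0)
  qed (simp_all add: coact_coeff_left_0)
  finally show ?thesis .
qed

text \<open>Two expressions for \<open>g \<xi>(d\<^sub>i \<otimes> d\<^sub>j)\<close>, one from the weight and one from the relation
  of the Yetter--Drinfeld datum, differ by the factor \<open>q\<close> to the power \<open>2(i + j)\<close>.\<close>

lemma xi_d_eq_0:
  assumes i: "i < N" and j: "j < N" and nd: "\<not> N dvd 2 * (i + j)"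
  shows "\<xi> (d i) (d j) = 0"
proof -
  let ?x = "\<xi> (d i) (d j)"
  have "g * (\<Sum>(h1, h2)\<leftarrow>\<Delta> ?x. sH (\<chi> h1) h2) = (\<Sum>(h1, h2)\<leftarrow>\<Delta> ?x. sH (\<chi> h2) h1) * g"
    using datum unfolding H.yd_datum_def by blast
  moreover have "(\<Sum>(h1, h2)\<leftarrow>\<Delta> ?x. sH (\<chi> h1) h2) = sH (q ^ (i + j)) ?x"
    using xi_convolve_left[OF i j, of "Suc 0"] N_ge by (simp only: conv_power_Suc_0) simp
  ultimately have "sH (q ^ (i + j)) (g * ?x) = ?x * g"
    using xi_convolve_right[OF i j] by simp
  then have "sH (q ^ (i + j) * q ^ (i + j)) (?x * g) = ?x * g"
    by (simp only: weight_xi[OF i j] H.scale_scale)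
  moreover have "q ^ (i + j) * q ^ (i + j) = q ^ (2 * (i + j))"
    by (simp only: mult_2 power_add)
  ultimately have "sH (q ^ (2 * (i + j))) (?x * g) = ?x * g" by simp
  then have "sH (q ^ (2 * (i + j)) - 1) (?x * g) = 0"
    by (simp only: H.scale_left_diff_distrib H.scale_one diff_self)
  moreover have "q ^ (2 * (i + j)) - 1 \<noteq> 0" using nd q_power_eq_1_iff[of "2 * (i + j)"] theta_eq_N by simp
  ultimately have "?x * g * S g = 0" by simp
  then show ?thesis by (simp add: mult.assoc antipode_g)
qed

lemma xi_scale [simp]: "\<xi> (sR c v) w = sH c (\<xi> v w)" "\<xi> v (sR c w) = sH c (\<xi> v w)"
    "\<xi> 0 w = 0" "\<xi> v 0 = 0"
proof -
  show "\<xi> (sR c v) w = sH c (\<xi> v w)" "\<xi> v (sR c w) = sH c (\<xi> v w)" for c v w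
    using xi_bilinear by (auto simp: k_bilinear_def lin_iff)
  from this(1)[of 0] this(2)[of _ 0] show "\<xi> 0 w = 0" "\<xi> v 0 = 0" by simp_all
qed

lemma xi_y_pow_eq_0: "\<not> N dvd 2 * (i + j) \<Longrightarrow> \<xi> (y_pow i) (y_pow j) = 0"
  by (cases "i < N"; cases "j < N") (simp_all add: y_pow_eq y_pow_eq_0 xi_d_eq_0)

text \<open>The cocycle identity at \<open>d 1\<close>, \<open>d b\<close>, \<open>d c\<close>.  The hypothesis on products removes all
  terms but the one with trivial second factor on each side.\<close>

lemma xi_y_pow_shift:
  assumes b: "b < N" and c: "c < N" "0 < c"
    and prods: "\<And>i j k l. i + j + k + l = Suc (b + c) \<Longrightarrow> 0 < i + j \<Longrightarrow> 0 < k + l \<Longrightarrow>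
      \<xi> (y_pow i) (y_pow j) * \<xi> (y_pow k) (y_pow l) = 0"
  shows "\<xi> (y_pow 1) (y_pow (b + c)) = \<xi> (y_pow (Suc b)) (y_pow c)"
proof -
  have 1: "Suc 0 < N" using N_ge by simp
  have prods': "\<xi> (m (d i) (d j)) (m (d i') (d j')) * \<xi> (d k) (d l) = 0"
    if "i < N" "j < N" "i' < N" "j' < N" "k < N" "l < N"
      "i + j + (i' + j') + k + l = Suc (b + c)" "0 < i + j + (i' + j')" "0 < k + l" for i j i' j' k l
    using prods[of "i + j" "i' + j'" k l] that
    by (simp add: d_mult) (simp add: d_eq_y_pow)
  have L: "(\<Sum>((a, e), (c', e'))\<leftarrow>comult2 (d b) (d c). \<xi> (d 1) (m a e) * \<xi> c' e') = \<xi> (d 1) (m (d b) (d c))"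
  proof -
    have "(\<Sum>((a, e), (c', e'))\<leftarrow>comult2 (d b) (d c). \<xi> (d 1) (m a e) * \<xi> c' e') =
       (\<Sum>s\<le>b. \<Sum>t\<le>c. sH (q ^ ((b - s) * t)) (\<xi> (d 1) (m (d s) (d t)) * \<xi> (d (b - s)) (d (c - t))))"
      by (rule sum_comult2_d[where sZ=sH]) (use b c theta_eq_N in \<open>simp_all\<close>, (intro lin_intros)+)
    also have "\<dots> = \<xi> (d 1) (m (d b) (d c))"
    proof (subst double_sum_single[where x=b and y=c], goal_cases)
      case (3 s t)
      then have "s < b \<or> t < c" by auto
      then have "s + t < b + c" using 3 by linarith
      then show ?case using 3 prods'[of 0 "Suc 0" s t "b - s" "c - t"] 1 b c by simp
    qed (use 1 in \<open>simp_all add: xi_0_left\<close>)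
    finally show ?thesis .
  qed
  have R: "(\<Sum>((a, e), (c', e'))\<leftarrow>comult2 (d 1) (d b). \<Sum>(x1, x2)\<leftarrow>\<Delta> (\<xi> c' e'). \<xi> (m a e) (x1 \<rhd> d c) * x2)
      = \<xi> (m (d 1) (d b)) (d c)"
  proof -
    have "(\<Sum>((a, e), (c', e'))\<leftarrow>comult2 (d 1) (d b). \<Sum>(x1, x2)\<leftarrow>\<Delta> (\<xi> c' e'). \<xi> (m a e) (x1 \<rhd> d c) * x2) =
       (\<Sum>s\<le>1. \<Sum>t\<le>b. sH (q ^ ((1 - s) * t)) (\<Sum>(x1, x2)\<leftarrow>\<Delta> (\<xi> (d (1 - s)) (d (b - t))).
          \<xi> (m (d s) (d t)) (x1 \<rhd> d c) * x2))"
      by (rule sum_comult2_d[where sZ=sH]) (use 1 b c theta_eq_N in \<open>simp_all\<close>, (intro lin_intros)+)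
    also have "\<dots> = (\<Sum>s\<le>1. \<Sum>t\<le>b. sH (q ^ ((1 - s) * t)) (sH (q ^ (c * (1 - s + (b - t))))
          (\<xi> (m (d s) (d t)) (d c) * \<xi> (d (1 - s)) (d (b - t)))))"
    proof (intro sum.cong refl arg_cong[where f="sH _"])
      fix s t
      have "(\<Sum>(x1, x2)\<leftarrow>\<Delta> (\<xi> (d (1 - s)) (d (b - t))). \<xi> (m (d s) (d t)) (x1 \<rhd> d c) * x2)
        = (\<Sum>(x1, x2)\<leftarrow>\<Delta> (\<xi> (d (1 - s)) (d (b - t))). \<xi> (m (d s) (d t)) (d c) * sH (H.conv_power \<chi> c x1) x2)"
        by (simp add: act_d[OF c(1)])
      also have "\<dots> = \<xi> (m (d s) (d t)) (d c) * (\<Sum>(x1, x2)\<leftarrow>\<Delta> (\<xi> (d (1 - s)) (d (b - t))). sH (H.conv_power \<chi> c x1) x2)"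
        by (rule scale_sum_list[where sA=sH and sB=sH, symmetric]) (intro lin_intros)
      finally show "(\<Sum>(x1, x2)\<leftarrow>\<Delta> (\<xi> (d (1 - s)) (d (b - t))). \<xi> (m (d s) (d t)) (x1 \<rhd> d c) * x2)
        = sH (q ^ (c * (1 - s + (b - t)))) (\<xi> (m (d s) (d t)) (d c) * \<xi> (d (1 - s)) (d (b - t)))"
        using xi_convolve_left[of "1 - s" "b - t" c] 1 b c by simp
    qed
    also have "\<dots> = \<xi> (m (d 1) (d b)) (d c)"
    proof (subst double_sum_single[where x=1 and y=b], goal_cases)
      case (3 s t)
      then have "s < 1 \<or> t < b" by auto
      then have "s + t < 1 + b" using 3 by linarith
      then show ?case using 3 prods'[of s t c 0 "1 - s" "b - t"] 1 b c by simp
    qed (use 1 in \<open>simp_all add: xi_0_left\<close>)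
    finally show ?thesis .
  qed
  have "\<xi> (d 1) (m (d b) (d c)) = \<xi> (m (d 1) (d b)) (d c)"
    using xi_cocycle[where r="d 1" and s="d b" and t="d c"] unfolding L R .
  then have "\<xi> (d 1) (m (y_pow b) (y_pow c)) = \<xi> (m (d 1) (y_pow b)) (y_pow c)"
    by (simp add: y_pow_eq b c H.scale_left_commute)
  moreover have "y_pow 1 = d 1" by (simp add: y_pow_rec)
  ultimately show ?thesis by (simp add: y_pow_add y_pow_rec(2))
qed

section \<open>The degrees N/2, N and 3N/2\<close>

lemma counit_y_pow: "0 < n \<Longrightarrow> \<epsilon> (y_pow n) = 0"
proof -
  assume "0 < n"
  then obtain n' where "n = Suc n'" by (cases n) auto
  then show ?thesis using N_ge by (simp add: y_pow_rec counit_m counit_d)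
qed

lemma xi_y_pow_0: "0 < n \<Longrightarrow> \<xi> (y_pow 0) (y_pow n) = 0" "0 < n \<Longrightarrow> \<xi> (y_pow n) (y_pow 0) = 0"
  by (simp_all only: y_pow_rec d_0 xi_unit_left xi_unit_right counit_y_pow H.scale_zero_left)

text \<open>The same, read as independence of the way in which the exponent \<open>n\<close> is split.\<close>

lemma xi_y_pow_split:
  assumes "i \<in> {1..n - 1}" "i \<le> N" "n < N + i"
    and prods: "\<And>i j k l. i + j + k + l = n \<Longrightarrow> 0 < i + j \<Longrightarrow> 0 < k + l \<Longrightarrow>
      \<xi> (y_pow i) (y_pow j) * \<xi> (y_pow k) (y_pow l) = 0"
  shows "\<xi> (y_pow i) (y_pow (n - i)) = \<xi> (y_pow 1) (y_pow (n - 1))"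
proof -
  have *: "Suc (i - 1 + (n - i)) = n" "i - 1 + (n - i) = n - 1" "Suc (i - 1) = i" using assms by auto
  have "\<xi> (y_pow 1) (y_pow (i - 1 + (n - i))) = \<xi> (y_pow (Suc (i - 1))) (y_pow (n - i))"
    by (rule xi_y_pow_shift) (use assms in auto)
  then show ?thesis using * by simp
qed

definition half_xi :: 'h where "half_xi = \<xi> (d 1) (d (N div 2 - 1))"

lemma xi_y_pow_half_degree:
  assumes "even N" "i \<in> {1..N div 2 - 1}"
  shows "\<xi> (y_pow i) (y_pow (N div 2 - i)) = sH (qfact q (N div 2 - 1)) half_xi"
proof -
  have "\<xi> (y_pow i) (y_pow (N div 2 - i)) = \<xi> (y_pow 1) (y_pow (N div 2 - 1))"
  proof (rule xi_y_pow_split)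
    fix i j k l assume "i + j + k + l = N div 2" "0 < i + j" "0 < k + l"
    then have "2 * (i + j) < N" "0 < 2 * (i + j)" by auto
    then have "\<not> N dvd 2 * (i + j)" by (metis nat_dvd_not_less)
    then show "\<xi> (y_pow i) (y_pow j) * \<xi> (y_pow k) (y_pow l) = 0"
      by (simp add: xi_y_pow_eq_0)
  qed (use assms in auto)
  moreover have "N div 2 - 1 < N" using N_ge by linarith
  ultimately show ?thesis by (simp add: y_pow_eq half_xi_def y_pow_rec)
qed

lemma xi_y_pow_half_multiple:
  assumes "even N" "i + j = N div 2"
  shows "\<exists>c. \<xi> (y_pow i) (y_pow j) = sH c half_xi"
proof -
  have N2: "0 < N div 2" using N_ge by linarith
  consider "i = 0" | "j = 0" | "0 < i" "0 < j" by blast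
  then show ?thesis
  proof cases
    case 1
    then show ?thesis using assms N2 xi_y_pow_0(1)[of j] by (intro exI[of _ 0]) simp
  next
    case 2
    then show ?thesis using assms N2 xi_y_pow_0(2)[of i] by (intro exI[of _ 0]) simp
  next
    case 3
    then have "i \<in> {1..N div 2 - 1}" "j = N div 2 - i" using assms by auto
    then show ?thesis using xi_y_pow_half_degree[OF assms(1)] by blast
  qed
qed

lemma xi_y_pow_full_degree:
  assumes "odd N \<or> half_xi * half_xi = 0" "i \<in> {1..N - 1}"
  shows "\<xi> (y_pow i) (y_pow (N - i)) = \<xi> (y_pow 1) (y_pow (N - 1))"
proof (rule xi_y_pow_split)
  fix i j k l assume *: "i + j + k + l = N" "0 < i + j" "0 < k + l"
  show "\<xi> (y_pow i) (y_pow j) * \<xi> (y_pow k) (y_pow l) = 0"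
  proof (cases "N dvd 2 * (i + j)")
    case True
    have "2 * (i + j) < 2 * N" "0 < 2 * (i + j)" using * by auto
    with True have ij: "2 * (i + j) = N" by (intro dvd_less_twice_eq)
    then have N: "even N" "i + j = N div 2" "k + l = N div 2" using * by auto
    then obtain c c' where "\<xi> (y_pow i) (y_pow j) = sH c half_xi" "\<xi> (y_pow k) (y_pow l) = sH c' half_xi"
      using xi_y_pow_half_multiple by meson
    then show ?thesis using assms(1) N by simp
  qed (simp add: xi_y_pow_eq_0)
qed (use assms in auto)

text \<open>If one of the two exponents reaches \<open>N\<close>, the corresponding power of \<open>y\<close> is already \<open>0\<close>;
  otherwise the value does not depend on the splitting and can be read off at \<open>i = 1\<close>.\<close>

lemma xi_y_pow_three_halves_degree:
  assumes N: "even N" "half_xi = 0" and i: "i \<in> {1..3 * (N div 2) - 1}"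
  shows "\<xi> (y_pow i) (y_pow (3 * (N div 2) - i)) = 0"
proof -
  define M where "M = N div 2"
  have M: "N = 2 * M" "0 < M" using N N_ge unfolding M_def by auto
  consider "N \<le> i" | "N \<le> 3 * M - i" | "i \<le> N" "3 * M < N + i" using M by linarith
  then show ?thesis
  proof cases
    case 3
    have "\<xi> (y_pow i) (y_pow (3 * M - i)) = \<xi> (y_pow 1) (y_pow (3 * M - 1))"
    proof (rule xi_y_pow_split)
      fix i j k l assume *: "i + j + k + l = 3 * M" "0 < i + j" "0 < k + l"
      have half: "\<xi> (y_pow i) (y_pow j) = 0" if "i + j = M" for i j
        using xi_y_pow_half_multiple[OF N(1), of i j] that N M_def by auto
      show "\<xi> (y_pow i) (y_pow j) * \<xi> (y_pow k) (y_pow l) = 0"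
      proof (cases "N dvd 2 * (i + j)")
        case True
        then obtain e where "2 * (i + j) = N * e" by blast
        then have e: "i + j = M * e" using M by simp
        then have "M * e < M * 3" using * by linarith
        then have "e < 3" using M by simp
        moreover have "e \<noteq> 0" using e * by auto
        ultimately consider "e = 1" | "e = 2" by linarith
        then show ?thesis
        proof cases
          case 1
          then show ?thesis using half e by simp
        next
          case 2
          then have "k + l = M" using * e by simp
          then show ?thesis using half by simp
        qed
      qed (simp add: xi_y_pow_eq_0)
    qed (use i 3 M_def in auto)
    also have "\<dots> = 0" using y_pow_eq_0[of "3 * M - 1"] M by simp
    finally show ?thesis by (simp add: M_def)
  qed (simp_all add: y_pow_eq_0 M_def)
qed

section \<open>Powers of Y in the bosonization\<close>

text \<open>The coordinates in \<open>H\<close> of an element of \<open>R \<otimes> H\<close>, regarded as a free \<open>H\<close>-module on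
  the basis \<open>d\<close>.\<close>

definition smash_coord :: "nat \<Rightarrow> ('r \<times> 'h) list \<Rightarrow> 'h" where
  "smash_coord j X = (\<Sum>(r, h)\<leftarrow>X. sH (\<phi> j r) h)"

lemma lin_m_tilde:
  assumes "k_bilinear sR sH sZ f"
  shows "lin sR sZ (\<lambda>s. \<Sum>(p, x)\<leftarrow>m_tilde r s. f p x)"
proof -
  have "lin sR sZ (\<lambda>p. f p x)" for x using assms by (auto simp: k_bilinear_def)
  then have vZ: "vector_space sZ" unfolding lin_iff by blast
  have "(\<Sum>(p, x)\<leftarrow>m_tilde r s. f p x) = (\<Sum>((a, b), (c, e))\<leftarrow>comult2 r s. f (m a b) (\<xi> c e))" for s
    unfolding m_tilde_def by (simp add: case_prod_unfold comp_def)
  then show ?thesis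
    unfolding sum_comult2
    by (simp only:) (intro lin_intros vZ lin_bilinear_left[OF assms] lin_bilinear_right[OF assms])
qed

lemma sum_m_tilde_y:
  assumes n: "n < N" and f: "k_bilinear sR sH sH f"
  shows "(\<Sum>(p, x)\<leftarrow>m_tilde (d 1) (d n). f p x) =
    f (m (d 1) (d n)) 1 + (\<Sum>t\<le>n. sH (q ^ t) (f (d t) (\<xi> (d 1) (d (n - t)))))"
proof -
  have f0: "f a 0 = 0" for a
  proof -
    have "lin sH sH (f a)" using f by (auto simp: k_bilinear_def)
    then interpret Vector_Spaces.linear sH sH "f a" .
    show ?thesis by (rule zero)
  qed
  have "(\<Sum>(p, x)\<leftarrow>m_tilde (d 1) (d n). f p x) = (\<Sum>((a, b), (c, e))\<leftarrow>comult2 (d 1) (d n). f (m a b) (\<xi> c e))"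
    unfolding m_tilde_def by (simp add: case_prod_unfold comp_def)
  also have "\<dots> = (\<Sum>s\<le>1. \<Sum>t\<le>n. sH (q ^ ((1 - s) * t)) (f (m (d s) (d t)) (\<xi> (d (1 - s)) (d (n - t)))))"
    by (rule sum_comult2_d[where sZ=sH])
      (use n N_ge theta_eq_N in \<open>simp_all\<close>, (intro lin_intros lin_bilinear_left[OF f] lin_bilinear_right[OF f])+)
  also have "\<dots> = (\<Sum>t\<le>n. sH (q ^ t) (f (d t) (\<xi> (d 1) (d (n - t)))))
      + (\<Sum>t\<le>n. f (m (d 1) (d t)) (\<xi> (d 0) (d (n - t))))"
    by simp
  also have "(\<Sum>t\<le>n. f (m (d 1) (d t)) (\<xi> (d 0) (d (n - t)))) = (\<Sum>t\<le>n. if t = n then f (m (d 1) (d n)) 1 else 0)"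
    by (intro sum.cong) (use n in \<open>auto simp: xi_0_left f0\<close>)
  finally show ?thesis by simp
qed

lemma coord_mult_y_d:
  assumes "n < N" "j < N"
  shows "\<phi> j (m (d 1) (d n)) = (if j = Suc n then qint q j else 0)"
proof (cases "Suc n < N")
  case True
  then show ?thesis using coord_y_d by simp
next
  case False
  then have "n = N - 1" using assms by simp
  then show ?thesis using y_d_top assms by auto
qed

lemma sum_coord_swap:
  assumes "\<And>n. lin sH sH (f n)"
  shows "(\<Sum>(s, k)\<leftarrow>Z. \<Sum>n<N. sH (\<phi> n s) (f n k)) = (\<Sum>n<N. f n (smash_coord n Z))"
  unfolding sum_list_swap smash_coord_def
  by (intro sum.cong refl, subst scale_sum_list[OF assms]) (use assms in \<open>simp add: lin_iff\<close>)

text \<open>As \<open>y\<close> is primitive with coaction \<open>g \<otimes> y\<close>, the product \<open>Y (d\<^sub>n \<otimes> h)\<close> is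
  \<open>y d\<^sub>n \<otimes> h\<close> plus the terms \<open>q\<^sup>j d\<^sub>j \<otimes> \<xi>(y \<otimes> d\<^sub>n\<^sub>-\<^sub>j) h\<close> for \<open>j \<le> n\<close>.\<close>

lemma smash_coord_y_mult:
  assumes j: "j < N"
  shows "smash_coord j (smash_mult [(d 1, 1)] Z) = sH (qint q j) (smash_coord (j - 1) Z)
    + (\<Sum>n<N. if j \<le> n then sH (q ^ j) (\<xi> (d 1) (d (n - j)) * smash_coord n Z) else 0)"
proof -
  define f where "f n k = sH (\<phi> j (m (d 1) (d n))) k
      + (if j \<le> n then sH (q ^ j) (\<xi> (d 1) (d (n - j)) * k) else 0)" for n k
  have lf: "lin sH sH (f n)" for n
    unfolding f_def by (auto simp: lin_iff vs algebra_simps H.scale_right_distrib mult.commute)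
  have "smash_coord j (smash_mult [(d 1, 1)] Z) =
     (\<Sum>(s, k)\<leftarrow>Z. \<Sum>(h1, h2)\<leftarrow>\<Delta> 1. \<Sum>(p, x)\<leftarrow>m_tilde (d 1) (h1 \<rhd> s). sH (\<phi> j p) (x * h2 * k))"
    unfolding smash_coord_def smash_mult_def
    by (simp add: sum_list_concat_map case_prod_unfold comp_def)
  also have "\<dots> = (\<Sum>(s, k)\<leftarrow>Z. \<Sum>n<N. sH (\<phi> n s) (f n k))"
  proof (intro arg_cong[where f=sum_list] map_cong refl, clarify)
    fix s k
    have "(\<Sum>(h1, h2)\<leftarrow>\<Delta> 1. \<Sum>(p, x)\<leftarrow>m_tilde (d 1) (h1 \<rhd> s). sH (\<phi> j p) (x * h2 * k))
       = (\<Sum>(p, x)\<leftarrow>m_tilde (d 1) (1 \<rhd> s). sH (\<phi> j p) (x * 1 * k))"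
      by (rule sum_comult_one[where sZ=sH]) (intro lin_intros lin_compose[OF lin_m_tilde])
    also have "\<dots> = (\<Sum>(p, x)\<leftarrow>m_tilde (d 1) s. sH (\<phi> j p) (x * k))" by (simp add: act_one)
    also have "\<dots> = (\<Sum>n<N. sH (\<phi> n s) (\<Sum>(p, x)\<leftarrow>m_tilde (d 1) (d n). sH (\<phi> j p) (x * k)))"
      by (rule lin_expand) (intro lin_intros lin_m_tilde)
    also have "\<dots> = (\<Sum>n<N. sH (\<phi> n s) (f n k))"
    proof (intro sum.cong refl arg_cong[where f="sH _"])
      fix n assume "n \<in> {..<N}"
      then have n: "n < N" by simp
      have "(\<Sum>(p, x)\<leftarrow>m_tilde (d 1) (d n). sH (\<phi> j p) (x * k)) = sH (\<phi> j (m (d 1) (d n))) (1 * k)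
         + (\<Sum>t\<le>n. sH (q ^ t) (sH (\<phi> j (d t)) (\<xi> (d 1) (d (n - t)) * k)))"
        by (rule sum_m_tilde_y[OF n]) (intro lin_intros)
      also have "(\<Sum>t\<le>n. sH (q ^ t) (sH (\<phi> j (d t)) (\<xi> (d 1) (d (n - t)) * k)))
        = (\<Sum>t\<le>n. if t = j then sH (q ^ j) (\<xi> (d 1) (d (n - j)) * k) else 0)"
        by (intro sum.cong) (use n in \<open>auto simp: coord_d\<close>)
      finally show "(\<Sum>(p, x)\<leftarrow>m_tilde (d 1) (d n). sH (\<phi> j p) (x * k)) = f n k"
        by (simp add: f_def)
    qed
    finally show "(\<Sum>(h1, h2)\<leftarrow>\<Delta> 1. \<Sum>(p, x)\<leftarrow>m_tilde (d 1) (h1 \<rhd> s). sH (\<phi> j p) (x * h2 * k))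
       = (\<Sum>n<N. sH (\<phi> n s) (f n k))" .
  qed
  also have "\<dots> = (\<Sum>n<N. f n (smash_coord n Z))" by (rule sum_coord_swap[OF lf])
  also have "\<dots> = (\<Sum>n<N. sH (\<phi> j (m (d 1) (d n))) (smash_coord n Z))
     + (\<Sum>n<N. if j \<le> n then sH (q ^ j) (\<xi> (d 1) (d (n - j)) * smash_coord n Z) else 0)"
    by (simp add: f_def sum.distrib)
  also have "(\<Sum>n<N. sH (\<phi> j (m (d 1) (d n))) (smash_coord n Z))
     = (\<Sum>n<N. if n = j - 1 then sH (qint q j) (smash_coord n Z) else 0)"
    by (intro sum.cong refl) (use j in \<open>cases j; auto simp: coord_mult_y_d[unfolded One_nat_def]\<close>)
  also have "\<dots> = sH (qint q j) (smash_coord (j - 1) Z)" using j by (simp add: less_imp_diff_less)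
  finally show ?thesis .
qed

text \<open>Stated with \<open>M\<close> and \<open>x\<close> as parameters so that it covers both parities: \<open>M = N/2\<close> for even
  \<open>N\<close>, and \<open>M = 1\<close>, \<open>x = 0\<close> for odd \<open>N\<close>, where \<open>\<xi>(y \<otimes> d\<^sub>k)\<close> is \<open>0\<close> below degree \<open>N\<close>.\<close>

lemma smash_coord_power:
  assumes M: "qint q M \<noteq> 0" and x: "x * x = 0"
    and xi_y: "\<And>k. Suc k < N \<Longrightarrow> \<xi> (d 1) (d k) = (if Suc k = M then x else 0)"
  shows "n < N \<Longrightarrow> j < N \<Longrightarrow> smash_coord j (smash_power [(d 1, 1)] n) =
      (if j = n then sH (qfact q n) 1 else 0) + (if j + M = n then sH (qfact q n / qint q M) x else 0)"
    and "j < N \<Longrightarrow> smash_coord j (smash_power [(d 1, 1)] N) =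
      (if j = 0 then sH (qfact q (N - 1)) (\<xi> (d 1) (d (N - 1))) else 0)"
proof -
  have M0: "0 < M" using M by (cases M) auto
  define A where "A n j = (if j = n then sH (qfact q n) 1 else 0)
      + (if j + M = n then sH (qfact q n / qint q M) x else 0)" for n j
  \<comment> \<open>The old summand with right factor \<open>x\<close> yields nothing new under \<open>\<xi>\<close>, as \<open>x * x = 0\<close>.\<close>
  have step: "smash_coord j (smash_power [(d 1, 1)] (Suc n)) =
      sH (qint q j) (A n (j - 1)) + (if j \<le> n then sH (q ^ j * qfact q n) (\<xi> (d 1) (d (n - j))) else 0)"
    if n: "n < N" and j: "j < N" and A: "\<And>j. j < N \<Longrightarrow> smash_coord j (smash_power [(d 1, 1)] n) = A n j"
    for n j
  proof -
    have "smash_coord j (smash_power [(d 1, 1)] (Suc n)) = sH (qint q j) (A n (j - 1))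
        + (\<Sum>k<N. if j \<le> k then sH (q ^ j) (\<xi> (d 1) (d (k - j)) * A n k) else 0)"
      unfolding smash_power.simps smash_coord_y_mult[OF j]
      using j by (auto intro!: arg_cong2[where f="(+)"] sum.cong simp: A[unfolded One_nat_def] less_imp_diff_less)
    also have "(\<Sum>k<N. if j \<le> k then sH (q ^ j) (\<xi> (d 1) (d (k - j)) * A n k) else 0)
        = (\<Sum>k<N. if k = n then if j \<le> n then sH (q ^ j * qfact q n) (\<xi> (d 1) (d (n - j))) else 0 else 0)"
    proof (intro sum.cong refl)
      fix k assume "k \<in> {..<N}"
      have "\<xi> (d 1) (d (k - j)) * (if k + M = n then sH (qfact q n / qint q M) x else 0) = 0"
        using xi_y[of "k - j"] n M0 x by auto
      then show "(if j \<le> k then sH (q ^ j) (\<xi> (d 1) (d (k - j)) * A n k) else 0) =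
        (if k = n then if j \<le> n then sH (q ^ j * qfact q n) (\<xi> (d 1) (d (n - j))) else 0 else 0)"
        by (simp add: A_def distrib_left)
    qed
    finally show ?thesis using n by simp
  qed
  \<comment> \<open>The two contributions to the coefficient of \<open>x\<close> add up by
    \<open>(j)\<^sub>q + q\<^sup>j (M)\<^sub>q = (j + M)\<^sub>q\<close>.\<close>
  have pascal: "sH (qint q j) (if 0 < j \<and> j - 1 + M = n then sH (qfact q n / qint q M) x else 0)
      + (if j \<le> n then sH (q ^ j * qfact q n) (if Suc (n - j) = M then x else 0) else 0)
      = (if j + M = Suc n then sH (qfact q (Suc n) / qint q M) x else 0)" for j n
  proof (cases "j + M = Suc n")
    case True
    then have "j \<le> n" "Suc (n - j) = M" using M0 by auto
    moreover have "sH (qint q j) (if 0 < j \<and> j - 1 + M = n then sH (qfact q n / qint q M) x else 0)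
        = sH (qint q j * qfact q n / qint q M) x" using True by (cases j) auto
    moreover have "qint q j * qfact q n / qint q M + q ^ j * qfact q n = qfact q (Suc n) / qint q M"
    proof -
      have "qfact q (Suc n) = qfact q n * (qint q j + q ^ j * qint q M)"
        using qfact_Suc[of q n] qint_add[of q j M] unfolding True by simp
      then show ?thesis using M by (simp add: field_simps)
    qed
    ultimately show ?thesis
      using True by (simp add: H.scale_left_distrib[symmetric])
  next
    case False
    then show ?thesis using M0 by auto
  qed
  have AA: "sH (qint q j) (A n (j - 1)) = (if j = Suc n then sH (qfact q (Suc n)) 1 else 0)
     + sH (qint q j) (if 0 < j \<and> j - 1 + M = n then sH (qfact q n / qint q M) x else 0)" for n j
    by (cases j) (auto simp: A_def qfact_Suc mult.commute H.scale_right_distrib)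
  have main: "\<And>j. j < N \<Longrightarrow> smash_coord j (smash_power [(d 1, 1)] n) = A n j" if "n < N" for n
    using that
  proof (induction n)
    case 0
    then show ?case using M0 N_ge
      by (simp add: smash_coord_def A_def d_0[symmetric] coord_d)
  next
    case (Suc n)
    have "\<xi> (d 1) (d (n - j)) = (if Suc (n - j) = M then x else 0)"
      using xi_y[of "n - j"] Suc.prems by simp
    then have "smash_coord j (smash_power [(d 1, 1)] (Suc n)) = sH (qint q j) (A n (j - 1))
        + (if j \<le> n then sH (q ^ j * qfact q n) (if Suc (n - j) = M then x else 0) else 0)"
      using step[of n j] Suc by simp
    also have "\<dots> = A (Suc n) j"
      unfolding AA add.assoc pascal by (simp add: A_def)
    finally show ?case .
  qed
  then show "n < N \<Longrightarrow> j < N \<Longrightarrow> smash_coord j (smash_power [(d 1, 1)] n) =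
      (if j = n then sH (qfact q n) 1 else 0) + (if j + M = n then sH (qfact q n / qint q M) x else 0)"
    by (simp add: A_def)
  assume j: "j < N"
  have N1: "Suc (N - 1) = N" "N - 1 < N" using N_ge by auto
  have *: "smash_coord j (smash_power [(d 1, 1)] N) = sH (qint q j) (A (N - 1) (j - 1))
        + (if j \<le> N - 1 then sH (q ^ j * qfact q (N - 1)) (\<xi> (d 1) (d (N - 1 - j))) else 0)"
    using step[OF N1(2) j main[OF N1(2)]] by (simp only: N1(1))
  show "smash_coord j (smash_power [(d 1, 1)] N) =
      (if j = 0 then sH (qfact q (N - 1)) (\<xi> (d 1) (d (N - 1))) else 0)"
  proof (cases "j = 0")
    case True
    then show ?thesis using * by simp
  next
    case False
    then have "\<xi> (d 1) (d (N - 1 - j)) = (if Suc (N - 1 - j) = M then x else 0)"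
      using j xi_y[of "N - 1 - j"] by simp
    then have "smash_coord j (smash_power [(d 1, 1)] N) = sH (qint q j) (A (N - 1) (j - 1))
        + (if j \<le> N - 1 then sH (q ^ j * qfact q (N - 1)) (if Suc (N - 1 - j) = M then x else 0) else 0)"
      by (simp only: *)
    also have "\<dots> = 0"
      unfolding AA add.assoc pascal N1(1) using j qfact_eq_0_iff[of N] by simp
    finally show ?thesis using False by simp
  qed
qed

text \<open>Conversely to \<open>teq_sum\<close>, coordinates detect equality of tensors.\<close>

lemma teq_coordinates: "teq sR sH X (map (\<lambda>j. (d j, smash_coord j X)) [0..<N])"
proof (induction X)
  case Nil
  have "teq sR sH [(v, 0)] []" for v
    using teq_trans[OF teq_sym[OF teq_scale[of sR sH 0 v 0]]] teq_zero[of sR sH 0] by simp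
  then have "teq sR sH (map (\<lambda>j. (d j, 0)) xs) []" for xs
    by (induction xs) (auto intro: teq_refl teq_append[of _ _ "[_]" "[]" _ "[]", simplified])
  then show ?case by (simp add: smash_coord_def teq_sym)
next
  case (Cons x X)
  obtain r h where x: "x = (r, h)" by (cases x)
  have "r = (\<Sum>j\<leftarrow>[0..<N]. sR (\<phi> j r) (d j))"
    by (subst expand) (simp add: interv_sum_list_conv_sum_set_nat atLeast0LessThan)
  then have "teq sR sH [(r, h)] (map (\<lambda>j. (sR (\<phi> j r) (d j), h)) [0..<N])"
    using teq_sum_left[of sR sH "\<lambda>j. sR (\<phi> j r) (d j)" "[0..<N]" h] by simp
  also have "teq sR sH \<dots> (map (\<lambda>j. (d j, sH (\<phi> j r) h)) [0..<N])"
    by (intro teq_map_cong teq_scale)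
  finally (teq_trans) have "teq sR sH ([(r, h)] @ X)
      (map (\<lambda>j. (d j, sH (\<phi> j r) h)) [0..<N] @ map (\<lambda>j. (d j, smash_coord j X)) [0..<N])"
    by (rule teq_append) (rule Cons.IH)
  also note teq_map_add
  finally (teq_trans) show ?case by (simp add: x smash_coord_def)
qed

lemma teq_if_smash_coord_eq:
  assumes "\<And>j. j < N \<Longrightarrow> smash_coord j X = smash_coord j Z"
  shows "teq sR sH X Z"
proof -
  have "map (\<lambda>j. (d j, smash_coord j X)) [0..<N] = map (\<lambda>j. (d j, smash_coord j Z)) [0..<N]"
    using assms by simp
  then show ?thesis using teq_coordinates[of X] teq_coordinates[of Z] by (metis teq_trans teq_sym)
qed

lemma smash_power_N:
  assumes "odd N \<or> half_xi * half_xi = 0"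
  shows "teq sR sH (smash_power [(d 1, 1)] N) [(u 1, \<xi> (d 1) (y_pow (N - 1)))]"
proof (rule teq_if_smash_coord_eq)
  fix j assume j: "j < N"
  have nd: "2 * Suc k = N" if "N dvd 2 * Suc k" "Suc k < N" for k
    using that by (intro dvd_less_twice_eq) auto
  have xi0: "\<xi> (d 1) (d k) = 0" if "Suc k < N" "2 * Suc k \<noteq> N" for k
    by (rule xi_d_eq_0) (use that nd[of k] in auto)
  have "smash_coord j (smash_power [(d 1, 1)] N) =
      (if j = 0 then sH (qfact q (N - 1)) (\<xi> (d 1) (d (N - 1))) else 0)"
  proof (cases "even N")
    case True
    show ?thesis
    proof (rule smash_coord_power(2)[OF _ _ _ j])
      show "half_xi * half_xi = 0" using assms True by blast
      have "\<not> N dvd N div 2" using N_ge by (intro nat_dvd_not_less) linarith+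
      then show "qint q (N div 2) \<noteq> 0" by (simp add: qint_eq_0_iff theta_eq_N)
      fix k assume k: "Suc k < N"
      show "\<xi> (d 1) (d k) = (if Suc k = N div 2 then half_xi else 0)"
      proof (cases "Suc k = N div 2")
        case True
        then have "k = N div 2 - 1" by simp
        then show ?thesis using True by (simp add: half_xi_def)
      next
        case False
        then have "2 * Suc k \<noteq> N" by auto
        then show ?thesis using False xi0[OF k] by simp
      qed
    qed
  next
    case False
    show ?thesis
    proof (rule smash_coord_power(2)[OF _ _ _ j])
      show "(0::'h) * 0 = 0" "qint q 1 \<noteq> 0" by simp_all
      show "\<xi> (d 1) (d k) = (if Suc k = 1 then 0 else 0)" if "Suc k < N" for k
      proof -
        have "2 * Suc k \<noteq> N" using False by auto
        then show ?thesis using xi0[OF that] by simp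
      qed
    qed
  qed
  then show "smash_coord j (smash_power [(d 1, 1)] N) = smash_coord j [(u 1, \<xi> (d 1) (y_pow (N - 1)))]"
    using N_ge by (simp add: smash_coord_def d_0[symmetric] coord_d y_pow_eq)
qed

end

section \<open>Cocycle values and powers of y for a thin pre-bialgebra\<close>

theorem proposition2p8:
  fixes sH :: "'k::field_char_0 \<Rightarrow> 'h::ring_1 \<Rightarrow> 'h"
    and \<Delta> :: "'h \<Rightarrow> ('h \<times> 'h) list" and \<epsilon>H :: "'h \<Rightarrow> 'k" and S :: "'h \<Rightarrow> 'h"
    and sR :: "'k \<Rightarrow> 'r::ab_group_add \<Rightarrow> 'r"
    and act :: "'h \<Rightarrow> 'r \<Rightarrow> 'r" and \<rho> :: "'r \<Rightarrow> ('h \<times> 'r) list"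
    and \<delta> :: "'r \<Rightarrow> ('r \<times> 'r) list" and \<epsilon> :: "'r \<Rightarrow> 'k"
    and m :: "'r \<Rightarrow> 'r \<Rightarrow> 'r" and u :: "'k \<Rightarrow> 'r" and \<xi> :: "'r \<Rightarrow> 'r \<Rightarrow> 'h"
    and N :: nat and y :: 'r and g x :: 'h and \<chi> :: "'h \<Rightarrow> 'k" and q :: 'k and d :: "nat \<Rightarrow> 'r"
    and pow :: "nat \<Rightarrow> 'r" and Y :: "('r \<times> 'h) list" and Pow :: "nat \<Rightarrow> ('r \<times> 'h) list"
  assumes cocycle: "pre_bialgebra_cocycle sH \<Delta> \<epsilon>H S sR act \<rho> \<delta> \<epsilon> m u \<xi>"
    and dim: "vector_space.dim sR (UNIV :: 'r set) = N"
    and thin: "coalgebra.thin sR \<delta> (u 1)"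
    and primitives: "coalgebra.primitives sR \<delta> (u 1) = module.span sR {y}"
    and datum: "yd_coalgebra.associated_datum sH \<Delta> \<epsilon>H sR act \<rho> y g \<chi>"
    and q: "q = \<chi> g"
    and basis: "pre_bialgebra.divided_power_basis \<Delta> \<epsilon>H sR act \<delta> m u N y g \<chi> d"
    and x: "even N \<Longrightarrow> x = \<xi> (d 1) (d (N div 2 - 1))"
    and pow: "pow = pre_bialgebra.power_R m u y"
    and Y: "Y = [(y, 1)]"
    and Pow: "Pow = pre_bialgebra_cocycle.smash_power \<Delta> act \<rho> \<delta> m u \<xi> Y"
  shows "(even N \<longrightarrow>
       (\<forall>i\<in>{1..N div 2 - 1}. \<xi> (pow i) (pow (N div 2 - i)) = sH (qfact q (N div 2 - 1)) x)) \<and>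
    (odd N \<or> (even N \<and> x ^ 2 = 0) \<longrightarrow>
       (\<forall>i\<in>{1..N - 1}. \<xi> (pow i) (pow (N - i)) = \<xi> y (pow (N - 1))) \<and>
       teq sR sH (Pow N) [(u 1, \<xi> y (pow (N - 1)))]) \<and>
    (even N \<and> x = 0 \<longrightarrow>
       (\<forall>i\<in>{1..3 * (N div 2) - 1}. \<xi> (pow i) (pow (3 * (N div 2) - i)) = 0))"
proof -
  interpret C: pre_bialgebra_cocycle sH \<Delta> \<epsilon>H S sR act \<rho> \<delta> \<epsilon> m u \<xi> by (rule cocycle)
  have "C.H.yd_datum g \<chi> (\<chi> g)" "teq sH sR (\<rho> y) [(g, y)]"
    and ex: "\<exists>\<theta>. 2 \<le> \<theta> \<and> \<theta> \<le> C.R.dim UNIV \<and> primitive_unity_root \<theta> (\<chi> g)"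
    using datum unfolding C.associated_datum_def by simp_all
  from ex obtain \<theta> where \<theta>: "2 \<le> \<theta>" "\<theta> \<le> N" "primitive_unity_root \<theta> q"
    using dim q by blast
  have d1: "d 1 = y"
    using basis unfolding C.divided_power_basis_def by (elim conjE)
  interpret divided_power_cocycle sH \<Delta> \<epsilon>H S sR act \<rho> \<delta> \<epsilon> m u \<xi> N \<theta> g \<chi> q d
    by unfold_locales
      (use \<theta> q d1 basis \<open>C.H.yd_datum g \<chi> (\<chi> g)\<close> \<open>teq sH sR (\<rho> y) [(g, y)]\<close> in simp_all)
  have P: "pow = y_pow" using pow d1 by (simp add: y_pow_def)
  have y: "y = y_pow 1" using d1 by (simp add: y_pow_rec)
  have Pow_N: "Pow N = C.smash_power [(d 1, 1)] N" using Pow Y d1 by simp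
  have xh: "x = half_xi" if "even N" using x[OF that] by (simp add: half_xi_def)
  have xx: "odd N \<or> half_xi * half_xi = 0" if "odd N \<or> (even N \<and> x ^ 2 = 0)"
    using that xh by (metis power2_eq_square)
  show ?thesis
  proof (intro conjI impI ballI)
    fix i assume "even N" "i \<in> {1..N div 2 - 1}"
    then show "\<xi> (pow i) (pow (N div 2 - i)) = sH (qfact q (N div 2 - 1)) x"
      unfolding P xh[OF \<open>even N\<close>] by (rule xi_y_pow_half_degree)
  next
    fix i assume "odd N \<or> (even N \<and> x ^ 2 = 0)" "i \<in> {1..N - 1}"
    then show "\<xi> (pow i) (pow (N - i)) = \<xi> y (pow (N - 1))"
      unfolding P y by (intro xi_y_pow_full_degree xx)
  next
    assume "odd N \<or> (even N \<and> x ^ 2 = 0)"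
    then show "teq sR sH (Pow N) [(u 1, \<xi> y (pow (N - 1)))]"
      unfolding P Pow_N d1[symmetric] by (intro smash_power_N xx)
  next
    fix i assume "even N \<and> x = 0" "i \<in> {1..3 * (N div 2) - 1}"
    then show "\<xi> (pow i) (pow (3 * (N div 2) - i)) = 0"
      unfolding P using xi_y_pow_three_halves_degree xh by metis
  qed
qed

end
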